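(* For each real $\alpha > -1$ there exists a constant $C_\alpha > 0$ such that the following holds. For every analytic map $\varphi \colon \mathbb{D} \to \mathbb{D}$ there exists $h_0 \in (0,1)$ such that for every $h \in (0,h_0)$, every $\varepsilon \in (0,1)$ and every $\xi \in \mathbb{T}$, $$\mathcal{A}_\alpha\big(\{z \in \mathbb{D} : \varphi(z) \in W(\xi, \varepsilon h)\}\big) \le C_\alpha\, \varepsilon^{\alpha+2}\, \mathcal{A}_\alpha\big(\{z \in \mathbb{D} : \varphi(z) \in W(\xi, h)\}\big).$$
   Context: $\mathbb{D} = \{z \in \mathbb{C} : |z|<1\}$ and $\mathbb{T} = \partial \mathbb{D}$. $\mathcal{A}$ is the normalized area measure $dx\,dy/\pi$ on $\mathbb{D}$, and for $\alpha > -1$, $d\mathcal{A}_\alpha(z) = (\alpha+1)(1-|z|^2)^\alpha\, d\mathcal{A}(z)$. For $\xi \in \mathbb{T}$ and $0<h<1$, the Carleson window is $W(\xi,h) = \{z \in \mathbb{D} : |z| \ge 1-h \text{ and } |\arg(z\bar{\xi})| \le h\}$, where $\arg$ takes values in $(-\pi,\pi]$. *)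

theory Defs
  imports "HOL-Analysis.Analysis"
begin

abbreviation unit_disc :: "complex set" ("\<D>")
  where "\<D> \<equiv> ball 0 1"

abbreviation unit_circle :: "complex set" ("\<T>")
  where "\<T> \<equiv> sphere 0 1"

definition disc_area :: "complex measure" ("\<A>")
  where "\<A> = density (restrict_space lborel \<D>) (\<lambda>_. ennreal (1 / pi))"

definition weighted_disc_area :: "real \<Rightarrow> complex measure" ("\<A>\<^bsub>_\<^esub>")
  where "\<A>\<^bsub>\<alpha>\<^esub> =
    density \<A> (\<lambda>z. ennreal ((\<alpha> + 1) * (1 - (cmod z)\<^sup>2) powr \<alpha>))"

text \<open>\<^const>\<open>Arg\<close> takes values in \<open>(-pi, pi]\<close>. Its conventional value at \<open>0\<close> is irrelevant
  here: for \<open>\<xi> \<in> \<T>\<close> and \<open>0 < h < 1\<close> the modulus condition excludes \<open>z = 0\<close>.\<close>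

definition carleson_window :: "complex \<Rightarrow> real \<Rightarrow> complex set"
  where "carleson_window \<xi> h = {z \<in> \<D>. cmod z \<ge> 1 - h \<and> \<bar>Arg (z * cnj \<xi>)\<bar> \<le> h}"

end

theory Submission
  imports Defs "HOL-Complex_Analysis.Complex_Analysis"
begin

text \<open>With \<open>f = (h/4) / (1 - cnj \<xi> * \<phi>)\<close>, which has positive real part, the event
  \<open>\<phi> \<in> W(\<xi>, \<epsilon>h)\<close> forces \<open>|f| > 1/(16\<epsilon>)\<close>, while \<open>|f| > 1\<close> forces \<open>\<phi> \<in> W(\<xi>, h)\<close>. So it
  suffices to prove the weak-type bound \<open>\<A>\<^bsub>\<alpha>\<^esub>(|f| > L) \<le> C L powr -(\<alpha> + 2) \<A>\<^bsub>\<alpha>\<^esub>(|f| > 1)\<close> for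
  \<open>f\<close> holomorphic with positive real part and \<open>|f 0| < 2\<close>.

  Every \<open>z\<close> with \<open>|f z| > L\<close> lies in \<open>cball w (1 - |w|)\<close> for a point \<open>w\<close> of the radius through \<open>z\<close>
  with \<open>|f w| = 2\<close>. By Vitali it is enough to consider disjoint balls of this kind. By
  Schwarz--Pick, \<open>|f| > 1\<close> on a smaller concentric ball, whose measure is comparable to
  \<open>d powr (\<alpha> + 2)\<close> with \<open>d = 1 - |w|\<close>. In the five times larger ball, Schwarz--Pick confines
  \<open>|f| > L\<close> to an annulus of width \<open>O(d/L)\<close>, and on each circle of that annulus Poisson's
  formula for the positive harmonic function \<open>Re (f / (f + L))\<close>, which is at least \<open>1/4\<close> where
  \<open>|f| > L\<close> and at most \<open>2/L\<close> at \<open>w\<close>, bounds the proportion of such points by \<open>O(d/L)\<close>.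
  Together these give measure \<open>O((d/L) powr (\<alpha> + 2))\<close> in each ball.\<close>

section \<open>Holomorphic functions with positive real part\<close>

text \<open>Cauchy's integral formula at \<open>v\<close> for
  \<open>f u * (1 - |v|^2) / (1 - cnj v * u)\<close>, whose value at \<open>v\<close> is
  \<open>f v\<close>. On the circle \<open>cnj u = 1 / u\<close> gives
  \<open>|u - v|^2 * u = (u - v) * (1 - cnj v * u)\<close>, which turns the product of this factor
  with the Cauchy kernel into the Poisson kernel.\<close>

lemma has_integral_Poisson_unit_circle:
  assumes "f holomorphic_on cball 0 1" "norm v < 1"
  shows "((\<lambda>t. f (exp (2 * of_real pi * \<i> * of_real t)) *
            of_real ((1 - (norm v)\<^sup>2) / (norm (exp (2 * of_real pi * \<i> * of_real t) - v))\<^sup>2))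
          has_integral f v) {0..1}"
proof -
  let ?e = "\<lambda>t::real. exp (2 * of_real pi * \<i> * of_real t)"
  have ne: "1 - cnj v * u \<noteq> 0" if "norm u \<le> 1" for u
  proof -
    have "norm (cnj v * u) < 1"
      using that assms(2) by (simp add: norm_mult) (metis mult_left_le norm_ge_zero order_le_less_trans)
    then show ?thesis by auto
  qed
  have hol: "(\<lambda>u. f u * of_real (1 - (norm v)\<^sup>2) / (1 - cnj v * u)) holomorphic_on cball 0 1"
    using ne by (intro holomorphic_intros assms) auto
  have one: "1 - cnj v * v = of_real (1 - (norm v)\<^sup>2)"
    by (metis complex_norm_square mult.commute of_real_1 of_real_diff)
  have "(norm v)\<^sup>2 < 1"
    using assms(2) by (simp add: abs_square_less_1)
  then have n0: "1 - (norm v)\<^sup>2 \<noteq> 0" by simp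
  have val: "f v * of_real (1 - (norm v)\<^sup>2) / (1 - cnj v * v) = f v"
    using n0 by (simp add: one del: of_real_diff)
  have *: "((\<lambda>x. f (?e x) * of_real (1 - (norm v)\<^sup>2) / (1 - cnj v * ?e x) / (?e x - v) *
             (2 * of_real pi * \<i> * ?e x)) has_integral (2 * of_real pi * \<i> * f v)) {0..1}"
    using Cauchy_integral_circlepath_simple[OF hol, of v, unfolded val] assms(2)
    unfolding has_contour_integral vector_derivative_circlepath unfolding circlepath
    by (simp add: mult_ac)
  have "((\<lambda>x. f (?e x) * of_real (1 - (norm v)\<^sup>2) / (1 - cnj v * ?e x) / (?e x - v) *
             (2 * of_real pi * \<i> * ?e x) / (2 * of_real pi * \<i>)) has_integral (2 * of_real pi * \<i> * f v) / (2 * of_real pi * \<i>)) {0..1}"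
    by (rule has_integral_divide[OF *])
  also have "(2 * of_real pi * \<i> * f v) / (2 * of_real pi * \<i>) = f v"
    by simp
  finally show ?thesis
  proof (rule has_integral_eq[rotated])
    fix x :: real
    let ?u = "?e x"
    have uu: "?u * cnj ?u = 1"
      by (simp add: exp_cnj flip: exp_add)
    have "norm ?u = 1" by simp
    then have a: "1 - cnj v * ?u \<noteq> 0" "?u \<noteq> v"
      using ne assms(2) by auto
    have "of_real ((norm (?u - v))\<^sup>2) * ?u = (?u - v) * (1 - cnj v * ?u)"
      unfolding complex_norm_square using uu by (simp add: algebra_simps)
    then have "1 / (1 - cnj v * ?u) / (?u - v) * ?u = 1 / of_real ((norm (?u - v))\<^sup>2)"
      using a by (simp add: divide_simps) (simp add: mult_ac)
    then have "f ?u * of_real (1 - (norm v)\<^sup>2) * (1 / (1 - cnj v * ?u) / (?u - v) * ?u) = f ?u * of_real (1 - (norm v)\<^sup>2) * (1 / of_real ((norm (?u - v))\<^sup>2))"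
      by simp
    then show "f ?u * of_real (1 - (norm v)\<^sup>2) / (1 - cnj v * ?u) / (?u - v) *
             (2 * of_real pi * \<i> * ?u) / (2 * of_real pi * \<i>) = f ?u * of_real ((1 - (norm v)\<^sup>2) / (norm (?u - v))\<^sup>2)"
      by (simp add: mult.assoc)
  qed
qed

text \<open>The Cayley map \<open>v \<mapsto> (v - f w) / (v + cnj (f w))\<close> takes the right
  half-plane into the unit disc and \<open>f w\<close> to 0. Composed with \<open>f\<close> and with
  the Moebius map sending 0 to \<open>w\<close>, it yields a self-map \<open>g\<close> of the disc
  fixing 0, and the Schwarz lemma applies to \<open>g\<close>.\<close>

lemma Schwarz_Pick_half_plane:
  assumes holf: "f holomorphic_on ball 0 1" and re: "\<And>z. norm z < 1 \<Longrightarrow> 0 < Re (f z)"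
    and w: "norm w < 1" and z: "norm z < 1"
  shows "norm (f z - f w) \<le> norm (Moebius_function 0 w z) * norm (f z + cnj (f w))"
proof -
  define g where "g u = (let v = f (Moebius_function 0 (-w) u) in (v - f w) / (v + cnj (f w)))" for u
  have nz: "v + cnj (f w) \<noteq> 0" if "Re v > 0" for v
    using re[OF w] that by (auto simp: complex_eq_iff)
  have lt: "norm (v - f w) < norm (v + cnj (f w))" if "Re v > 0" for v
  proof -
    have "0 < Re v * Re (f w)" using re[OF w] that by simp
    then show ?thesis
    unfolding cmod_def
      by (intro real_sqrt_less_mono) (simp add: power2_eq_square algebra_simps)
  qed
  have mob: "norm (Moebius_function 0 (-w) u) < 1" if "norm u < 1" for u
    using Moebius_function_norm_lt_1[of "-w" u] w that by simp
  have "(\<lambda>u. f (Moebius_function 0 (-w) u)) holomorphic_on ball 0 1"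
    using w mob
    by (intro holomorphic_on_compose_gen[OF Moebius_function_holomorphic holf, unfolded o_def]) auto
  then have "g holomorphic_on ball 0 1"
    unfolding g_def Let_def using mob re nz by (intro holomorphic_intros) auto
  moreover have "g 0 = 0" by (simp add: g_def Moebius_function_of_zero)
  moreover have "norm (g u) < 1" if "norm u < 1" for u
    using lt[OF re[OF mob[OF that]]] nz[OF re[OF mob[OF that]]]
    by (simp add: g_def Let_def norm_divide)
  moreover have "norm (Moebius_function 0 w z) < 1"
    using w z by (rule Moebius_function_norm_lt_1)
  ultimately have "norm (g (Moebius_function 0 w z)) \<le> norm (Moebius_function 0 w z)"
    by (rule Schwarz_Lemma)
  moreover have "Moebius_function 0 (-w) (Moebius_function 0 w z) = z"
    using Moebius_function_compose[of "-w" w z] w z by simp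
  ultimately show ?thesis
    using nz[OF re[OF z]] by (simp add: g_def Let_def norm_divide field_simps)
qed

text \<open>Rests on the identity
  \<open>|1 - cnj w * z|^2 - |z - w|^2 = (1 - |w|^2) * (1 - |z|^2)\<close>. It converts a bound on
  the pseudo-hyperbolic distance from \<open>w\<close> to \<open>z\<close> into one on the distance
  of \<open>z\<close> from the circle.\<close>

lemma one_minus_norm_Moebius_function:
  assumes "norm w < 1" "norm z < 1"
  shows "(1 - (norm (Moebius_function 0 w z))\<^sup>2) * (norm (1 - cnj w * z))\<^sup>2 =
         (1 - (norm w)\<^sup>2) * (1 - (norm z)\<^sup>2)"
proof -
  have "norm (cnj w * z) < 1"
    using assms by (simp add: norm_mult) (metis mult_less_cancel_left2 mult_left_le norm_ge_zero not_le order_le_less_trans order_less_imp_le)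
  then have nz: "1 - cnj w * z \<noteq> 0" by auto
  then have "(1 - (norm (Moebius_function 0 w z))\<^sup>2) * (norm (1 - cnj w * z))\<^sup>2 =
      (norm (1 - cnj w * z))\<^sup>2 - (norm (z - w))\<^sup>2"
    by (simp add: Moebius_function_simple norm_divide power_divide left_diff_distrib)
  also have "\<dots> = (1 - (norm w)\<^sup>2) * (1 - (norm z)\<^sup>2)"
    unfolding cmod_power2 by (simp add: algebra_simps power2_eq_square)
  finally show ?thesis .
qed

section \<open>Area measure on the disc\<close>

text \<open>Both measures give every open box the product of its side lengths, and this determines
  Lebesgue measure. The purpose is to move sets to \<open>real^2\<close>, where the invariance of
  measure under orthogonal transformations is applied.\<close>

lemma lborel_complex_eq_distr_vec:
  "lborel = distr (lborel :: (real^2) measure) borel (\<lambda>v. Complex (vec_nth v 1) (vec_nth v 2))"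
proof (rule lborel_eqI)
  have m: "(\<lambda>v::real^2. Complex (vec_nth v 1) (vec_nth v 2)) \<in> borel_measurable borel"
    unfolding Complex_eq by measurable
  fix l u :: complex
  assume le: "\<And>b. b \<in> Basis \<Longrightarrow> l \<bullet> b \<le> u \<bullet> b"
  have inner_vector: "(vector [a, b] :: real^2) \<bullet> axis i c = (if i = 1 then a else b) * c" for a b c i
    using exhaust_2[of i] by (auto simp: inner_axis)
  let ?l = "vector [Re l, Im l] :: real^2" and ?u = "vector [Re u, Im u] :: real^2"
  have "(\<lambda>v. Complex (vec_nth v 1) (vec_nth v 2)) -` box l u = box ?l ?u"
    by (auto simp: mem_box_cart in_box_complex_iff forall_2)
  then have "emeasure (distr (lborel :: (real^2) measure) borel (\<lambda>v. Complex (vec_nth v 1) (vec_nth v 2))) (box l u)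
     = emeasure lborel (box ?l ?u)"
    using m by (subst emeasure_distr) auto
  also have "\<dots> = ennreal (\<Prod>b\<in>Basis. (?u - ?l) \<bullet> b)"
    using le[of 1] le[of \<i>] 
    by (subst emeasure_lborel_box) (auto simp: Basis_vec_def inner_vector)
  also have "(\<Prod>b\<in>Basis. (?u - ?l) \<bullet> b) = (\<Prod>b\<in>Basis. (u - l) \<bullet> b)"
    using axis_eq_axis[of "1::2" "1::real" 2 "1::real"]
    by (simp add: Basis_vec_def UNIV_2 inner_vector Basis_complex_def inner_diff_left insert_commute[of "axis 2 1"])
  finally show "emeasure (distr (lborel :: (real^2) measure) borel (\<lambda>v. Complex (vec_nth v 1) (vec_nth v 2))) (box l u)
     = ennreal (\<Prod>b\<in>Basis. (u - l) \<bullet> b)" .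
qed simp

text \<open>It suffices to compare the two measures on boxes. In real coordinates the preimage of a
  box under multiplication by \<open>c\<close> is its image under the inverse rotation, which is
  orthogonal and so preserves measure.\<close>

lemma distr_lborel_complex_rotation:
  fixes c :: complex
  assumes c: "norm c = 1"
  shows "distr lborel borel (\<lambda>z. c * z) = lborel"
proof (rule lborel_eqI[symmetric])
  let ?J = "\<lambda>v::real^2. Complex (vec_nth v 1) (vec_nth v 2)"
  \<comment> \<open>In coordinates, \<open>?T\<close> is multiplication by \<open>cnj c\<close>, the
    inverse of \<open>c\<close> since \<open>c\<close> has modulus 1.\<close>
  let ?T = "\<lambda>v::real^2. (vector [Re c * vec_nth v 1 + Im c * vec_nth v 2, Re c * vec_nth v 2 - Im c * vec_nth v 1] :: real^2)"
  have cc: "(Re c)\<^sup>2 + (Im c)\<^sup>2 = 1"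
    using c by (metis cmod_power2 one_power2)
  have m: "?J \<in> borel_measurable borel"
    unfolding Complex_eq by measurable
  have mc: "(\<lambda>z. c * z) \<in> borel_measurable borel" by measurable
  have em: "emeasure (lborel :: complex measure) A = emeasure lborel (?J -` A)" if "A \<in> sets borel" for A
    using m that by (subst lborel_complex_eq_distr_vec, subst emeasure_distr) auto
  have "linear ?T"
    by (auto simp: linear_iff vec_eq_iff forall_2 algebra_simps)
  moreover have "norm (?T v) = norm v" for v
  proof -
    have "(norm (?T v))\<^sup>2 = ((Re c)\<^sup>2 + (Im c)\<^sup>2) * (norm v)\<^sup>2"
      unfolding power2_norm_eq_inner by (simp add: inner_vec_def sum_2 power2_eq_square algebra_simps)
    then show ?thesis using cc by simp
  qed
  ultimately have orth: "orthogonal_transformation ?T"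
    by (simp add: orthogonal_transformation)
  have cT: "c * ?J (?T v) = ?J v" for v
  proof -
    have "Re c * (Re c * a + Im c * b) - Im c * (Re c * b - Im c * a) = ((Re c)\<^sup>2 + (Im c)\<^sup>2) * a"
      "Re c * (Re c * b - Im c * a) + Im c * (Re c * a + Im c * b) = ((Re c)\<^sup>2 + (Im c)\<^sup>2) * b" for a b
      by (simp_all add: power2_eq_square algebra_simps)
    then show ?thesis
      by (simp add: complex_eq_iff cc)
  qed
  have JT: "?J -` (\<lambda>z. c * z) -` S = ?T ` (?J -` S)" for S
  proof (intro equalityI subsetI)
    fix v assume v: "v \<in> ?J -` (\<lambda>z. c * z) -` S"
    from surjD[OF orthogonal_transformation_surj[OF orth], of v] obtain u where u: "v = ?T u" ..
    have "?J u \<in> S" using v unfolding u vimage_eq cT .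
    then show "v \<in> ?T ` (?J -` S)" unfolding u by (intro imageI vimageI2)
  next
    fix v assume "v \<in> ?T ` (?J -` S)"
    then obtain u where u: "v = ?T u" "?J u \<in> S" by blast
    then show "v \<in> ?J -` (\<lambda>z. c * z) -` S" unfolding vimage_eq u(1) cT by simp
  qed
  fix l u :: complex
  assume le: "\<And>b. b \<in> Basis \<Longrightarrow> l \<bullet> b \<le> u \<bullet> b"
  have Jbox: "?J -` box l u = box (vector [Re l, Im l]) (vector [Re u, Im u])"
    by (auto simp: mem_box_cart in_box_complex_iff forall_2)
  have lm: "?J -` box l u \<in> lmeasurable"
    unfolding Jbox by simp
  have mb: "?J -` (\<lambda>z. c * z) -` box l u \<in> sets borel"
    using measurable_sets_borel[OF m measurable_sets_borel[OF mc borel_open[OF open_box]]] .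
  have "emeasure (distr lborel borel (\<lambda>z. c * z)) (box l u) = emeasure lborel ((\<lambda>z. c * z) -` box l u)"
    using mc by (subst emeasure_distr) auto
  also have "\<dots> = emeasure lborel (?J -` (\<lambda>z. c * z) -` box l u)"
    by (rule em) (rule measurable_sets_borel[OF mc borel_open[OF open_box]])
  also have "\<dots> = emeasure lebesgue (?J -` (\<lambda>z. c * z) -` box l u)"
    using mb by (subst emeasure_completion) auto
  also have "\<dots> = ennreal (measure lebesgue (?T ` (?J -` box l u)))"
    unfolding JT by (intro emeasure_eq_measure2 measurable_orthogonal_image[OF orth lm])
  also have "\<dots> = emeasure lebesgue (?J -` box l u)"
    unfolding measure_orthogonal_image[OF orth lm] using lm by (simp add: emeasure_eq_measure2)
  also have "\<dots> = emeasure lborel (?J -` box l u)"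
    using measurable_sets_borel[OF m borel_open[OF open_box]] by (subst emeasure_completion) auto
  also have "\<dots> = emeasure lborel (box l u)"
    by (rule em[symmetric]) simp
  also have "\<dots> = ennreal (\<Prod>b\<in>Basis. (u - l) \<bullet> b)"
    using le by (rule emeasure_lborel_box)
  finally show "emeasure (distr lborel borel (\<lambda>z. c * z)) (box l u) = ennreal (\<Prod>b\<in>Basis. (u - l) \<bullet> b)" .
qed simp

text \<open>A substitute for integration in polar coordinates: average over rotations, which preserve
  Lebesgue measure, and exchange the integrals.\<close>

lemma nn_integral_indicator_le_circle_mean:
  fixes W :: "complex \<Rightarrow> ennreal"
  assumes W[measurable]: "W \<in> borel_measurable borel" and E[measurable]: "E \<in> sets borel"
    and rot: "\<And>z c. norm c = 1 \<Longrightarrow> W (c * z) = W z"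
    and mean: "\<And>z. W z \<noteq> 0 \<Longrightarrow>
      (\<integral>\<^sup>+t\<in>{0..1}. indicator E (z * exp (2 * of_real pi * \<i> * of_real t)) \<partial>lborel) \<le> \<kappa>"
  shows "(\<integral>\<^sup>+z. W z * indicator E z \<partial>lborel) \<le> \<kappa> * (\<integral>\<^sup>+z. W z \<partial>lborel)"
proof -
  let ?e = "\<lambda>t::real. exp (2 * of_real pi * \<i> * of_real t) :: complex"
  have [measurable]: "?e \<in> borel_measurable borel"
    by (intro borel_measurable_continuous_onI continuous_intros)
  have *: "(\<integral>\<^sup>+z. W z * indicator E z \<partial>lborel) = (\<integral>\<^sup>+z. W z * indicator E (z * ?e t) \<partial>lborel)" for t
  proof -
    have n: "norm (?e t) = 1" by simp
    have "(\<integral>\<^sup>+z. W z * indicator E z \<partial>lborel)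
        = (\<integral>\<^sup>+z. W z * indicator E z \<partial>distr lborel borel (\<lambda>z. ?e t * z))"
      using distr_lborel_complex_rotation[OF n] by simp
    also have "\<dots> = (\<integral>\<^sup>+z. W (?e t * z) * indicator E (?e t * z) \<partial>lborel)"
      by (subst nn_integral_distr) auto
    finally show ?thesis
      using rot[OF n] by (simp add: mult.commute)
  qed
  \<comment> \<open>The interval \<open>{0..1}\<close> has length 1, so a quantity independent of
    \<open>t\<close> equals its own average over \<open>t\<close>.\<close>
  have "(\<integral>\<^sup>+z. W z * indicator E z \<partial>lborel) = (\<integral>\<^sup>+t\<in>{0..1::real}. (\<integral>\<^sup>+z. W z * indicator E z \<partial>lborel) \<partial>lborel)"
    by (subst nn_integral_cmult) auto
  also have "\<dots> = (\<integral>\<^sup>+t\<in>{0..1}. (\<integral>\<^sup>+z. W z * indicator E (z * ?e t) \<partial>lborel) \<partial>lborel)"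
    by (simp only: *[symmetric])
  also have "\<dots> = (\<integral>\<^sup>+t. (\<integral>\<^sup>+z. W z * indicator E (z * ?e t) * indicator {0..1} t \<partial>lborel) \<partial>lborel)"
    by (simp add: nn_integral_multc)
  also have "\<dots> = (\<integral>\<^sup>+z. (\<integral>\<^sup>+t. W z * indicator E (z * ?e t) * indicator {0..1} t \<partial>lborel) \<partial>lborel)"
    by (rule lborel_pair.Fubini') measurable
  also have "\<dots> = (\<integral>\<^sup>+z. W z * (\<integral>\<^sup>+t\<in>{0..1}. indicator E (z * ?e t) \<partial>lborel) \<partial>lborel)"
    by (subst nn_integral_cmult[symmetric]) (auto simp: mult.assoc)
  also have "\<dots> \<le> (\<integral>\<^sup>+z. \<kappa> * W z \<partial>lborel)"
  proof (rule nn_integral_mono)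
    fix z show "W z * (\<integral>\<^sup>+t\<in>{0..1}. indicator E (z * ?e t) \<partial>lborel) \<le> \<kappa> * W z"
      using mult_left_mono[OF mean[of z], of "W z"] by (cases "W z = 0") (simp_all add: mult.commute)
  qed
  also have "\<dots> = \<kappa> * (\<integral>\<^sup>+z. W z \<partial>lborel)"
    by (rule nn_integral_cmult) simp
  finally show ?thesis .
qed

section \<open>Weight integrals over thin annuli at the boundary circle\<close>

lemma emeasure_annulus_le:
  assumes t: "t > 0"
  shows "emeasure lborel {z::complex. 0 < 1 - (norm z)\<^sup>2 \<and> 1 - (norm z)\<^sup>2 < t} \<le> ennreal (pi * t)" (is "emeasure _ ?A \<le> _")
proof (cases "t \<le> 1")
  case True
  let ?r = "sqrt (1 - t)"
  have sub: "?A \<subseteq> ball 0 1 - ball 0 ?r"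
  proof
    fix z :: complex assume "z \<in> ?A"
    then have "(norm z)\<^sup>2 < 1\<^sup>2" "1 - t < (norm z)\<^sup>2" by auto
    then have "norm z < 1" "?r < norm z"
      by (auto intro: power2_less_imp_less real_less_lsqrt)
    then show "z \<in> ball 0 1 - ball 0 ?r" by auto
  qed
  have "emeasure lborel ?A \<le> emeasure lborel (ball 0 1 - ball 0 ?r :: complex set)"
    by (intro emeasure_mono sub) auto
  also have "\<dots> = emeasure lborel (ball 0 1 :: complex set) - emeasure lborel (ball 0 ?r :: complex set)"
    using t by (intro emeasure_Diff) (auto simp: emeasure_ball subset_ball True)
  also have "\<dots> = ennreal (pi * t)"
    using True t by (simp add: emeasure_ball unit_ball_vol_2 ennreal_minus algebra_simps)
  finally show ?thesis .
next
  case False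
  have "?A \<subseteq> ball 0 1" 
    by (auto simp: abs_square_less_1)
  then have "emeasure lborel ?A \<le> emeasure lborel (ball 0 1 :: complex set)"
    by (intro emeasure_mono) auto
  also have "\<dots> \<le> ennreal (pi * t)"
    using False by (simp add: emeasure_ball unit_ball_vol_2 ennreal_leI)
  finally show ?thesis .
qed

text \<open>The quotient \<open>x / y\<close> lies between \<open>a\<close> and \<open>b\<close>,
  and \<open>powr\<close> is monotone or antitone in its base according to the sign of
  \<open>\<alpha>\<close>. Taking \<open>max\<close> and \<open>min\<close> of the endpoint values
  covers both signs at once.\<close>

lemma powr_le_max_mult:
  fixes x y \<alpha> :: real
  assumes "a * y \<le> x" "x \<le> b * y" "0 < a" "0 < y"
  shows "x powr \<alpha> \<le> max (a powr \<alpha>) (b powr \<alpha>) * y powr \<alpha>"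
    and "min (a powr \<alpha>) (b powr \<alpha>) * y powr \<alpha> \<le> x powr \<alpha>"
proof -
  have pos: "0 < x / y" "a \<le> x / y" "x / y \<le> b"
    using assms by (auto simp: field_simps intro: less_le_trans mult_pos_pos)
  have x: "x powr \<alpha> = (x / y) powr \<alpha> * y powr \<alpha>"
    using pos assms by (subst powr_mult[symmetric]) auto
  have "(x / y) powr \<alpha> \<le> max (a powr \<alpha>) (b powr \<alpha>) \<and> min (a powr \<alpha>) (b powr \<alpha>) \<le> (x / y) powr \<alpha>"
  proof (cases "\<alpha> \<ge> 0")
    case True
    then show ?thesis using powr_mono2[of \<alpha> "x / y" b] powr_mono2[of \<alpha> a "x / y"] pos assms by auto
  next
    case False
    then show ?thesis using powr_mono2'[of \<alpha> "x / y" b] powr_mono2'[of \<alpha> a "x / y"] pos assms by auto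
  qed
  then show "x powr \<alpha> \<le> max (a powr \<alpha>) (b powr \<alpha>) * y powr \<alpha>"
    and "min (a powr \<alpha>) (b powr \<alpha>) * y powr \<alpha> \<le> x powr \<alpha>"
    unfolding x by (auto intro!: mult_right_mono)
qed

lemma nn_integral_weight_annulus_le:
  fixes \<alpha> :: real
  assumes "\<alpha> > -1"
  obtains C where "C > 0" "\<And>\<eta>. \<eta> > 0 \<Longrightarrow>
    (\<integral>\<^sup>+z\<in>{z::complex. 0 < 1 - (norm z)\<^sup>2 \<and> 1 - (norm z)\<^sup>2 < \<eta>}. ennreal ((1 - (norm z)\<^sup>2) powr \<alpha>) \<partial>lborel)
      \<le> ennreal (C * \<eta> powr (\<alpha> + 1))"
proof -
  \<comment> \<open>On the \<open>k\<close>-th dyadic shell \<open>1 - |z|^2\<close> is between 1/2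
    and 1 times \<open>\<eta> / 2 ^ k\<close>, so \<open>M\<close> compares the weight there with
    \<open>(\<eta> / 2 ^ k) powr \<alpha>\<close>. Multiplied by the shell's area, at most
    \<open>pi * \<eta> / 2 ^ k\<close>, this gives a geometric series of ratio
    \<open>\<rho>\<close>. The ratio is below 1 because \<open>\<alpha> > -1\<close>.\<close>
  define M where "M = max ((1/2) powr \<alpha>) (1 powr \<alpha>)"
  define \<rho> where "\<rho> = (1/2) powr (\<alpha> + 1)"
  have M: "M > 0" unfolding M_def by (simp add: less_max_iff_disj)
  have \<rho>: "0 < \<rho>" "\<rho> < 1"
    unfolding \<rho>_def using assms powr_less_mono2[of "\<alpha> + 1" "1/2" 1] by auto
  let ?q = "\<lambda>z::complex. 1 - (norm z)\<^sup>2"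
  have "(\<integral>\<^sup>+z\<in>{z. 0 < ?q z \<and> ?q z < \<eta>}. ennreal (?q z powr \<alpha>) \<partial>lborel)
      \<le> ennreal (M * pi / (1 - \<rho>) * \<eta> powr (\<alpha> + 1))" if \<eta>: "\<eta> > 0" for \<eta>
  proof -
    \<comment> \<open>A dyadic decomposition, because the weight is unbounded at the circle when \<open>\<alpha> < 0\<close>.\<close>
    let ?R = "\<lambda>k. {z. \<eta> / 2 ^ Suc k \<le> ?q z \<and> ?q z < \<eta> / 2 ^ k}"
    let ?c = "\<lambda>k. ennreal (M * (\<eta> / 2 ^ k) powr \<alpha>)"
    have R[measurable]: "?R k \<in> sets borel" for k by measurable
    have "(\<integral>\<^sup>+z\<in>{z. 0 < ?q z \<and> ?q z < \<eta>}. ennreal (?q z powr \<alpha>) \<partial>lborel)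
       \<le> (\<integral>\<^sup>+z. (\<Sum>k. ?c k * indicator (?R k) z) \<partial>lborel)"
    proof (rule nn_integral_mono)
      fix z
      show "ennreal (?q z powr \<alpha>) * indicator {z. 0 < ?q z \<and> ?q z < \<eta>} z \<le> (\<Sum>k. ?c k * indicator (?R k) z)"
      proof (cases "0 < ?q z \<and> ?q z < \<eta>")
        case True
        have ex: "\<exists>k. \<eta> / 2 ^ Suc k \<le> ?q z"
        proof -
          obtain n where "\<eta> / ?q z < 2 ^ n" 
            using real_arch_pow[of 2 "\<eta> / ?q z"] by auto
          then have "\<eta> / 2 ^ n < ?q z" using True by (simp add: field_simps)
          moreover have "\<eta> / 2 ^ Suc n \<le> \<eta> / 2 ^ n" using \<eta> by (simp add: field_simps)
          ultimately show ?thesis by (intro exI[of _ n]) auto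
        qed
        \<comment> \<open>The least admissible index puts \<open>z\<close> in the shell
          \<open>?R k\<close>: minimality gives the upper bound, except for \<open>k = 0\<close>,
          where it is the assumption \<open>?q z < \<eta>\<close>.\<close>
        define k where "k = (LEAST k. \<eta> / 2 ^ Suc k \<le> ?q z)"
        have k1: "\<eta> / 2 ^ Suc k \<le> ?q z" unfolding k_def using ex by (rule LeastI_ex)
        have k2: "?q z < \<eta> / 2 ^ k"
        proof (cases k)
          case 0 then show ?thesis using True by simp
        next
          case (Suc j)
          then have "\<not> \<eta> / 2 ^ Suc j \<le> ?q z" unfolding k_def by (metis lessI not_less_Least)
          then show ?thesis using Suc by simp
        qed
        have "?q z powr \<alpha> \<le> M * (\<eta> / 2 ^ k) powr \<alpha>"
          unfolding M_def by (rule powr_le_max_mult) (use k1 k2 \<eta> in auto)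
        then have "ennreal (?q z powr \<alpha>) \<le> ?c k * indicator (?R k) z"
          using k1 k2 by (simp add: ennreal_leI)
        also have "\<dots> \<le> (\<Sum>k. ?c k * indicator (?R k) z)"
        proof -
          have "F k \<le> suminf F" for F :: "nat \<Rightarrow> ennreal"
            using sum_le_suminf[of F "{k}"] by simp
          then show ?thesis .
        qed
        finally show ?thesis using True by simp
      qed auto
    qed
    also have "\<dots> = (\<Sum>k. \<integral>\<^sup>+z. ?c k * indicator (?R k) z \<partial>lborel)"
      by (rule nn_integral_suminf) simp
    also have "\<dots> = (\<Sum>k. ?c k * emeasure lborel (?R k))"
      by (simp add: nn_integral_cmult_indicator)
    also have "\<dots> \<le> (\<Sum>k. ennreal (M * pi * \<eta> powr (\<alpha> + 1) * \<rho> ^ k))"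
    proof (intro suminf_le)
      fix k
      have "emeasure lborel (?R k) \<le> emeasure lborel {z::complex. 0 < ?q z \<and> ?q z < \<eta> / 2 ^ k}"
        using \<eta> by (intro emeasure_mono) (auto intro: less_le_trans[rotated])
      also have "\<dots> \<le> ennreal (pi * (\<eta> / 2 ^ k))"
        using \<eta> by (intro emeasure_annulus_le) auto
      finally have "?c k * emeasure lborel (?R k) \<le> ?c k * ennreal (pi * (\<eta> / 2 ^ k))"
        by (rule mult_left_mono) simp
      also have "\<dots> = ennreal (M * (\<eta> / 2 ^ k) powr \<alpha> * (pi * (\<eta> / 2 ^ k)))"
        using M \<eta> by (intro ennreal_mult''[symmetric]) simp
      also have "M * (\<eta> / 2 ^ k) powr \<alpha> * (pi * (\<eta> / 2 ^ k)) = M * pi * (\<eta> / 2 ^ k) powr (\<alpha> + 1)"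
        using \<eta> by (simp add: powr_add)
      also have "(\<eta> / 2 ^ k) powr (\<alpha> + 1) = \<eta> powr (\<alpha> + 1) * \<rho> ^ k"
      proof -
        have "\<eta> / 2 ^ k = \<eta> * ((1/2) powr real k)"
          by (simp add: powr_realpow power_one_over field_simps)
        then show ?thesis
          unfolding \<rho>_def using \<eta> by (simp add: powr_mult powr_powr powr_realpow[symmetric] mult.commute del: powr_realpow)
      qed
      finally show "?c k * emeasure lborel (?R k) \<le> ennreal (M * pi * \<eta> powr (\<alpha> + 1) * \<rho> ^ k)"
        by (simp add: mult.assoc)
    qed auto
    also have "\<dots> = ennreal (\<Sum>k. M * pi * \<eta> powr (\<alpha> + 1) * \<rho> ^ k)"
      using M \<rho> by (intro suminf_ennreal2) (auto intro!: summable_mult summable_geometric)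
    also have "(\<Sum>k. M * pi * \<eta> powr (\<alpha> + 1) * \<rho> ^ k) = M * pi / (1 - \<rho>) * \<eta> powr (\<alpha> + 1)"
      using \<rho> by (subst suminf_mult) (auto simp: suminf_geometric summable_geometric)
    finally show ?thesis .
  qed
  moreover have "M * pi / (1 - \<rho>) > 0" using M \<rho> by simp
  ultimately show thesis using that by blast
qed

section \<open>The weighted disc area as an integral against Lebesgue measure\<close>

lemma sets_weighted_disc_area: "sets \<A>\<^bsub>\<alpha>\<^esub> = sets (restrict_space lborel \<D>)"
  by (simp add: weighted_disc_area_def disc_area_def)

lemma sets_weighted_disc_areaI: "E \<in> sets borel \<Longrightarrow> E \<subseteq> \<D> \<Longrightarrow> E \<in> sets \<A>\<^bsub>\<alpha>\<^esub>"
  by (auto simp: sets_weighted_disc_area sets_restrict_space_iff)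

lemma emeasure_weighted_disc_area:
  assumes "\<alpha> > -1" and E[measurable]: "E \<in> sets borel" and sub: "E \<subseteq> \<D>"
  shows "emeasure \<A>\<^bsub>\<alpha>\<^esub> E =
    ennreal ((\<alpha> + 1) / pi) * (\<integral>\<^sup>+z\<in>E. ennreal ((1 - (norm z)\<^sup>2) powr \<alpha>) \<partial>lborel)"
proof -
  let ?w = "\<lambda>z::complex. (1 - (norm z)\<^sup>2) powr \<alpha>"
  have E': "E \<in> sets \<A>" using sub by (auto simp: disc_area_def sets_restrict_space_iff)
  have w: "(\<lambda>z. ennreal ((\<alpha> + 1) * ?w z)) \<in> borel_measurable (restrict_space lborel \<D>)"
    by (intro measurable_restrict_space1) measurable
  have "emeasure \<A>\<^bsub>\<alpha>\<^esub> E = (\<integral>\<^sup>+z\<in>E. ennreal ((\<alpha> + 1) * ?w z) \<partial>\<A>)"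
    unfolding weighted_disc_area_def using E' w
    by (intro emeasure_density) (auto simp: disc_area_def)
  also have "\<dots> = (\<integral>\<^sup>+z. ennreal (1 / pi) * (ennreal ((\<alpha> + 1) * ?w z) * indicator E z) \<partial>restrict_space lborel \<D>)"
    unfolding disc_area_def using E' w
    by (intro nn_integral_density) (auto simp: disc_area_def)
  also have "\<dots> = (\<integral>\<^sup>+z. ennreal (1 / pi) * (ennreal ((\<alpha> + 1) * ?w z) * indicator E z) * indicator \<D> z \<partial>lborel)"
    by (rule nn_integral_restrict_space) auto
  also have "\<dots> = (\<integral>\<^sup>+z. ennreal ((\<alpha> + 1) / pi) * (ennreal (?w z) * indicator E z) \<partial>lborel)"
    using assms(1) sub
    by (intro nn_integral_cong) (auto simp: indicator_def divide_inverse mult_ac simp flip: ennreal_mult'')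
  also have "\<dots> = ennreal ((\<alpha> + 1) / pi) * (\<integral>\<^sup>+z\<in>E. ennreal (?w z) \<partial>lborel)"
    by (rule nn_integral_cmult) simp
  finally show ?thesis .
qed

text \<open>With \<open>d = 1 - |w|\<close>, on this ball \<open>1 - |z|^2\<close> stays between
  \<open>3/4 * d\<close> and \<open>5/2 * d\<close>. Hence the weight is at least a constant times
  \<open>d powr \<alpha>\<close>, and the ball has area \<open>pi * d^2 / 16\<close>.\<close>

lemma emeasure_weighted_disc_area_cball_ge:
  fixes \<alpha> :: real
  assumes "\<alpha> > -1"
  obtains c where "c > 0" "\<And>w. w \<in> \<D> \<Longrightarrow>
    ennreal (c * (1 - norm w) powr (\<alpha> + 2)) \<le> emeasure \<A>\<^bsub>\<alpha>\<^esub> (cball w ((1 - norm w) / 4))"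
proof -
  define m where "m = min ((3/4) powr \<alpha>) ((5/2) powr \<alpha>)"
  have m: "m > 0" by (simp add: m_def)
  have "ennreal ((\<alpha> + 1) / pi * (m * pi / 16) * (1 - norm w) powr (\<alpha> + 2)) \<le> emeasure \<A>\<^bsub>\<alpha>\<^esub> (cball w ((1 - norm w) / 4))"
    if "w \<in> \<D>" for w
  proof -
    define d where "d = 1 - norm w"
    have d: "0 < d" "d \<le> 1" using that by (auto simp: d_def)
    let ?B = "cball w (d / 4)"
    have nz: "norm w - d / 4 \<le> norm z" "norm z \<le> norm w + d / 4" if "z \<in> ?B" for z
      using that norm_triangle_ineq2[of w z] norm_triangle_ineq3[of w z]
      by (auto simp: dist_norm)
    have sub: "?B \<subseteq> \<D>"
    proof
      fix z assume "z \<in> ?B"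
      then have "norm z \<le> norm w + d / 4" by (rule nz(2))
      also have "\<dots> < 1" using d by (simp add: d_def field_simps)
      finally show "z \<in> \<D>" by simp
    qed
    have "ennreal (m * d powr \<alpha>) * emeasure lborel ?B = (\<integral>\<^sup>+z\<in>?B. ennreal (m * d powr \<alpha>) \<partial>lborel)"
      by (simp add: nn_integral_cmult_indicator)
    also have "\<dots> \<le> (\<integral>\<^sup>+z\<in>?B. ennreal ((1 - (norm z)\<^sup>2) powr \<alpha>) \<partial>lborel)"
    proof (intro nn_integral_mono)
      fix z
      show "ennreal (m * d powr \<alpha>) * indicator ?B z \<le> ennreal ((1 - (norm z)\<^sup>2) powr \<alpha>) * indicator ?B z"
      proof (cases "z \<in> ?B")
        case True
        define s where "s = 1 - norm z"
        have s: "3/4 * d \<le> s" "s \<le> 5/4 * d" "s \<le> 1" using nz[OF True] by (auto simp: s_def d_def field_simps)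
        have e: "1 - (norm z)\<^sup>2 = s * (2 - s)" by (simp add: s_def power2_eq_square algebra_simps)
        have "s * 1 \<le> s * (2 - s)" "s * (2 - s) \<le> s * 2"
          using s d by (intro mult_left_mono; simp)+
        then have "3/4 * d \<le> s * (2 - s)" "s * (2 - s) \<le> 5/2 * d"
          using s by linarith+
        then have "m * d powr \<alpha> \<le> (1 - (norm z)\<^sup>2) powr \<alpha>"
          unfolding m_def e using s d by (intro powr_le_max_mult(2)) simp_all
        then show ?thesis using True by (simp add: ennreal_leI)
      qed auto
    qed
    finally have "ennreal ((\<alpha> + 1) / pi) * (ennreal (m * d powr \<alpha>) * emeasure lborel ?B) \<le> emeasure \<A>\<^bsub>\<alpha>\<^esub> ?B"
      using emeasure_weighted_disc_area[OF assms _ sub] by (simp add: mult_left_mono)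
    also have "emeasure lborel ?B = ennreal (pi * (d / 4)\<^sup>2)"
      using d by (simp add: emeasure_cball unit_ball_vol_2)
    also have "ennreal ((\<alpha> + 1) / pi) * (ennreal (m * d powr \<alpha>) * ennreal (pi * (d / 4)\<^sup>2)) =
      ennreal ((\<alpha> + 1) / pi * (m * d powr \<alpha> * (pi * (d / 4)\<^sup>2)))"
    proof -
      have "ennreal a * (ennreal b * ennreal c) = ennreal (a * (b * c))" if "b \<ge> 0" "c \<ge> 0" for a b c
        using that by (simp add: ennreal_mult'')
      then show ?thesis using m by simp
    qed
    also have "(\<alpha> + 1) / pi * (m * d powr \<alpha> * (pi * (d / 4)\<^sup>2)) = (\<alpha> + 1) / pi * (m * pi / 16) * d powr (\<alpha> + 2)"
      using d by (simp add: powr_add power_divide)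
    finally show ?thesis by (simp add: d_def)
  qed
  moreover have "(\<alpha> + 1) / pi * (m * pi / 16) > 0" using assms m by simp
  ultimately show thesis using that by blast
qed

section \<open>The weak-type estimate\<close>

text \<open>Schwarz--Pick with \<open>|f z + cnj (f w)| \<le> |f z| + |f w|\<close> on the right and
  the reverse triangle inequality on the left, once in each order. The modulus of \<open>f\<close>
  thus satisfies a Harnack inequality in the pseudo-hyperbolic distance.\<close>

lemma half_plane_Harnack:
  assumes holf: "f holomorphic_on ball 0 1" and re: "\<And>z. norm z < 1 \<Longrightarrow> 0 < Re (f z)"
    and w: "norm w < 1" and z: "norm z < 1"
  shows "norm (f z) * (1 - norm (Moebius_function 0 w z)) \<le> norm (f w) * (1 + norm (Moebius_function 0 w z))"
    and "norm (f w) * (1 - norm (Moebius_function 0 w z)) \<le> norm (f z) * (1 + norm (Moebius_function 0 w z))"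
proof -
  let ?r = "norm (Moebius_function 0 w z)"
  have "norm (f z - f w) \<le> ?r * norm (f z + cnj (f w))"
    by (rule Schwarz_Pick_half_plane[OF holf re w z])
  also have "\<dots> \<le> ?r * (norm (f z) + norm (f w))"
    using norm_triangle_ineq[of "f z" "cnj (f w)"] by (intro mult_left_mono) auto
  finally have *: "norm (f z - f w) \<le> ?r * (norm (f z) + norm (f w))" .
  show "norm (f z) * (1 - ?r) \<le> norm (f w) * (1 + ?r)"
    using * norm_triangle_ineq2[of "f z" "f w"] by (simp add: algebra_simps)
  show "norm (f w) * (1 - ?r) \<le> norm (f z) * (1 + ?r)"
    using * norm_triangle_ineq2[of "f w" "f z"] by (simp add: algebra_simps norm_minus_commute)
qed

text \<open>Since \<open>|1 - cnj w * z| \<ge> 1 - |w|\<close>, the pseudo-hyperbolic distance from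
  \<open>w\<close> is at most 1/4 on this ball. Harnack then gives
  \<open>|f z| \<ge> 2 * (3/4) / (5/4) = 6/5\<close>.\<close>

lemma half_plane_large_on_cball:
  assumes holf: "f holomorphic_on ball 0 1" and re: "\<And>z. norm z < 1 \<Longrightarrow> 0 < Re (f z)"
    and w: "norm w < 1" "norm (f w) = 2" and z: "z \<in> cball w ((1 - norm w) / 4)"
  shows "norm z < 1" "norm (f z) > 1"
proof -
  let ?r = "norm (Moebius_function 0 w z)"
  have dz: "norm (z - w) \<le> (1 - norm w) / 4" using z by (simp add: dist_norm norm_minus_commute)
  then show z1: "norm z < 1" using norm_triangle_ineq2[of z w] w by (simp add: field_simps)
  have "norm (cnj w * z) \<le> norm w * 1"
    unfolding norm_mult complex_mod_cnj using z1 by (intro mult_left_mono) auto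
  then have "1 - norm w \<le> norm (1 - cnj w * z)"
    using norm_triangle_ineq2[of 1 "cnj w * z"] by simp
  then have "?r \<le> (1 - norm w) / 4 / (1 - norm w)"
    unfolding Moebius_function_simple norm_divide using dz w by (intro frac_le) auto
  also have "\<dots> = 1/4"
  proof -
    have "d / 4 / d = 1/4" if "d > 0" for d :: real using that by simp
    then show ?thesis using w by simp
  qed
  finally have r: "?r \<le> 1/4" .
  have "2 * (1 - ?r) \<le> norm (f z) * (1 + ?r)"
    using half_plane_Harnack(2)[OF holf re w(1) z1] w(2) by simp
  also have "\<dots> \<le> norm (f z) * (5/4)" using r by (intro mult_left_mono) auto
  finally show "norm (f z) > 1" using r by simp
qed

text \<open>Let \<open>r\<close> be the pseudo-hyperbolic distance from \<open>w\<close> to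
  \<open>z\<close>, and \<open>d = 1 - |w|\<close>. Harnack gives \<open>L * (1 - r) < 4\<close>, so
  \<open>r\<close> is close to 1. The Moebius identity with
  \<open>|1 - cnj w * z| \<le> 7 * d\<close> gives
  \<open>1 - |z|^2 \<le> 2 * 7^2 * (1 - r) * d\<close>, and \<open>392 = 4 * 98\<close>.\<close>

lemma half_plane_large_near_boundary:
  assumes holf: "f holomorphic_on ball 0 1" and re: "\<And>z. norm z < 1 \<Longrightarrow> 0 < Re (f z)"
    and w: "norm w < 1" "norm (f w) = 2" and z: "norm z < 1" "norm (z - w) \<le> 5 * (1 - norm w)"
    and L: "norm (f z) > L" "L > 0"
  shows "1 - (norm z)\<^sup>2 < 392 * (1 - norm w) / L"
proof -
  define d where "d = 1 - norm w"
  let ?r = "norm (Moebius_function 0 w z)" and ?q = "1 - (norm z)\<^sup>2"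
  have d: "d > 0" using w by (simp add: d_def)
  have q: "?q > 0" using z by (simp add: abs_square_less_1)
  have r: "?r < 1" using w z by (intro Moebius_function_norm_lt_1)
  \<comment> \<open>Expanding around \<open>z = w\<close> bounds this by \<open>7 * d\<close>: at
    most \<open>2 * d\<close> from \<open>1 - |w|^2\<close>, and at most \<open>5 * d\<close> from
    \<open>|z - w|\<close>.\<close>
  have "1 - cnj w * z = of_real (1 - (norm w)\<^sup>2) - cnj w * (z - w)"
    by (simp add: complex_norm_square algebra_simps del: of_real_power)
  then have "norm (1 - cnj w * z) \<le> \<bar>1 - (norm w)\<^sup>2\<bar> + norm w * norm (z - w)"
    by (metis norm_triangle_ineq4 norm_of_real norm_mult complex_mod_cnj)
  also have "\<dots> \<le> 2 * d + 1 * (5 * d)"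
  proof (intro add_mono mult_mono)
    have "1 - (norm w)\<^sup>2 = d * (1 + norm w)" by (simp add: d_def power2_eq_square algebra_simps)
    also have "\<dots> \<le> d * 2" using w d by (intro mult_left_mono) auto
    finally show "\<bar>1 - (norm w)\<^sup>2\<bar> \<le> 2 * d"
      using w by (simp add: abs_square_le_1)
  qed (use w z d in \<open>auto simp: d_def\<close>)
  finally have n7: "norm (1 - cnj w * z) \<le> 7 * d" by simp
  have "d * ?q \<le> (1 - (norm w)\<^sup>2) * ?q"
  proof (rule mult_right_mono)
    have "norm w * norm w \<le> norm w" using w by (simp add: mult_left_le)
    then show "d \<le> 1 - (norm w)\<^sup>2" by (simp add: d_def power2_eq_square)
  qed (use q in simp)
  also have "\<dots> = (1 - ?r\<^sup>2) * (norm (1 - cnj w * z))\<^sup>2"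
    using one_minus_norm_Moebius_function[OF w(1) z(1)] by simp
  also have "\<dots> \<le> (1 - ?r\<^sup>2) * (7 * d)\<^sup>2"
    using n7 r by (intro mult_left_mono power_mono) (auto simp: abs_square_le_1)
  also have "1 - ?r\<^sup>2 = (1 - ?r) * (1 + ?r)" by (simp add: power2_eq_square algebra_simps)
  also have "\<dots> * (7 * d)\<^sup>2 \<le> (1 - ?r) * 2 * (7 * d)\<^sup>2"
    using r by (intro mult_right_mono mult_left_mono) auto
  finally have "d * ?q \<le> d * ((1 - ?r) * 98 * d)" by (simp add: power2_eq_square algebra_simps)
  then have qr: "?q \<le> (1 - ?r) * 98 * d" using d by simp
  have "L * (1 - ?r) < norm (f z) * (1 - ?r)" using L r by simp
  also have "\<dots> \<le> 2 * (1 + ?r)" using half_plane_Harnack(1)[OF holf re w(1) z(1)] w(2) by simp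
  also have "\<dots> \<le> 4" using r by simp
  finally have "L * (1 - ?r) * (98 * d) < 4 * (98 * d)" using d by (intro mult_strict_right_mono) auto
  moreover have "L * ?q \<le> L * ((1 - ?r) * 98 * d)" using qr L by (intro mult_left_mono) auto
  ultimately have "L * ?q < 392 * d" by (simp add: algebra_simps)
  then show ?thesis using L by (simp add: d_def field_simps)
qed

text \<open>A large modulus does not make \<open>Re a\<close> large, so \<open>Re a\<close> cannot
  detect \<open>|a| > L\<close>. This expression serves as a harmonic substitute for the indicator
  of that event. All three bounds come from
  \<open>Re (a / (a + L)) = (|a|^2 + L * Re a) / |a + L|^2\<close> and from
  \<open>|a + L| \<ge> L\<close>, or \<open>|a + L| \<le> 2 * |a|\<close> when
  \<open>|a| > L\<close>.\<close>

lemma Re_divide_add_of_real: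
  fixes a :: complex and L :: real
  assumes a: "Re a > 0" and L: "L > 0"
  shows "Re (a / (a + of_real L)) \<ge> 0"
    and "Re (a / (a + of_real L)) \<le> norm a / L"
    and "norm a > L \<Longrightarrow> Re (a / (a + of_real L)) \<ge> 1 / 4"
proof -
  let ?n = "norm (a + of_real L)"
  have "L \<le> Re (a + of_real L)" using a by simp
  also have "\<dots> \<le> ?n" by (rule complex_Re_le_cmod)
  finally have n: "L \<le> ?n" .
  have "Re (a * cnj (a + of_real L)) = (norm a)\<^sup>2 + L * Re a"
    unfolding cmod_power2 by (simp add: power2_eq_square algebra_simps)
  then have Re: "Re (a / (a + of_real L)) = ((norm a)\<^sup>2 + L * Re a) / ?n\<^sup>2"
    by (subst complex_div_cnj) (simp flip: of_real_power)
  show "Re (a / (a + of_real L)) \<ge> 0"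
    unfolding Re using a L by simp
  have "Re (a / (a + of_real L)) \<le> norm (a / (a + of_real L))" by (rule complex_Re_le_cmod)
  also have "\<dots> \<le> norm a / L"
    unfolding norm_divide using n L by (intro divide_left_mono mult_pos_pos) auto
  finally show "Re (a / (a + of_real L)) \<le> norm a / L" .
  assume aL: "norm a > L"
  have "?n \<le> 2 * norm a" using norm_triangle_ineq[of a "of_real L"] aL L by simp
  then have "?n\<^sup>2 \<le> (2 * norm a)\<^sup>2" by (intro power_mono) auto
  also have "\<dots> \<le> 4 * ((norm a)\<^sup>2 + L * Re a)" using a L by (simp add: power_mult_distrib)
  finally have "?n\<^sup>2 \<le> 4 * ((norm a)\<^sup>2 + L * Re a)" .
  moreover have "?n\<^sup>2 > 0" using n L by (intro zero_less_power) linarith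
  ultimately show "Re (a / (a + of_real L)) \<ge> 1 / 4"
    unfolding Re by (simp add: pos_le_divide_eq)
qed

lemma sets_borel_vimage_continuous_on:
  assumes "continuous_on A f" "A \<in> sets borel" "B \<in> sets borel"
  shows "{z \<in> A. f z \<in> B} \<in> sets borel"
proof -
  have "f -` B \<inter> space (restrict_space borel A) \<in> sets (restrict_space borel A)"
    using assms by (intro measurable_sets[OF borel_measurable_continuous_on_restrict]) auto
  moreover have "f -` B \<inter> space (restrict_space borel A) = {z \<in> A. f z \<in> B}"
    by (auto simp: space_restrict_space)
  ultimately show ?thesis
    using assms(2) by (simp add: sets_restrict_space_iff)
qed

text \<open>With \<open>d = 1 - |w|\<close>, the indicator along the circle is at most
  \<open>200 * d\<close> times \<open>h\<close>, the product of the substitute indicator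
  \<open>Re (g (e t))\<close> and the Poisson kernel. By Poisson's formula \<open>h\<close> has
  integral \<open>Re (g v) \<le> 2 / L\<close>, whence the constant 400.\<close>

lemma half_plane_circle_mean_le:
  fixes f :: "complex \<Rightarrow> complex"
  defines "E \<equiv> \<lambda>w L. {z \<in> ball 0 1. norm (f z) > L} \<inter> cball w (5 * (1 - norm w))"
  assumes holf: "f holomorphic_on ball 0 1" and re: "\<And>z. norm z < 1 \<Longrightarrow> 0 < Re (f z)"
    and w: "norm w < 1" "norm (f w) = 2" and L: "L > 0"
    and z: "norm z < 1" "1 - (norm z)\<^sup>2 \<le> (1 - norm w) / 2"
  shows "(\<integral>\<^sup>+t\<in>{0..1}. indicator (E w L) (z * exp (2 * of_real pi * \<i> * of_real t)) \<partial>lborel)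
          \<le> ennreal (400 * (1 - norm w) / L)"
proof -
  define d where "d = 1 - norm w"
  \<comment> \<open>The dilation \<open>u \<mapsto> z * u\<close> takes the unit circle to the
    circle through \<open>z\<close>, and \<open>v\<close> to \<open>w\<close>. Poisson's formula on
    the unit disc can therefore be evaluated at \<open>v\<close>.\<close>
  define v where "v = w / z"
  define e where "e t = exp (2 * of_real pi * \<i> * of_real t)" for t :: real
  define g where "g u = f (z * u) / (f (z * u) + of_real L)" for u
  define K where "K t = (1 - (norm v)\<^sup>2) / (norm (e t - v))\<^sup>2" for t
  define h where "h t = Re (g (e t)) * K t" for t
  have ne: "norm (e t) = 1" for t by (simp add: e_def)
  have d: "d > 0" using w by (simp add: d_def)
  \<comment> \<open>Here \<open>|w|^2 \<le> 1 - d\<close> and \<open>|z|^2 \<ge> 1 - d / 2\<close>.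
    So \<open>w\<close> lies inside the circle through \<open>z\<close>, with a quantitative gap
    that bounds the numerator of the kernel from below.\<close>
  have "norm w * norm w \<le> norm w * 1" using w by (intro mult_left_mono) auto
  then have zw: "(norm z)\<^sup>2 - (norm w)\<^sup>2 \<ge> d / 2"
    using z by (simp add: d_def power2_eq_square)
  then have "(norm w)\<^sup>2 < (norm z)\<^sup>2" using d by linarith
  then have "norm w < norm z" by (rule power2_less_imp_less) simp
  then have z0: "z \<noteq> 0" by auto
  have v1: "norm v < 1" using z0 \<open>norm w < norm z\<close> by (simp add: v_def norm_divide)
  have zu: "norm (z * u) < 1" if "norm u \<le> 1" for u
  proof -
    have "norm z * norm u \<le> norm z * 1" using that by (intro mult_left_mono) auto
    then show ?thesis using z by (simp add: norm_mult)
  qed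
  have nz: "f x + of_real L \<noteq> 0" if "norm x < 1" for x
    using re[OF that] L by (auto simp: complex_eq_iff)
  have "(\<lambda>u. f (z * u)) holomorphic_on cball 0 1"
    using zu by (intro holomorphic_on_compose_gen[OF _ holf, unfolded o_def] holomorphic_intros) auto
  then have holg: "g holomorphic_on cball 0 1"
    unfolding g_def using zu nz by (intro holomorphic_intros) auto
  have eK: "K t = ((norm z)\<^sup>2 - (norm w)\<^sup>2) / (norm (z * e t - w))\<^sup>2" for t
  proof -
    have "z * e t - w = z * (e t - v)" using z0 by (simp add: v_def algebra_simps)
    moreover have "(norm z)\<^sup>2 - (norm w)\<^sup>2 = (norm z)\<^sup>2 * (1 - (norm v)\<^sup>2)"
      using z0 by (simp add: v_def norm_divide power_divide algebra_simps)
    ultimately show ?thesis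
      using z0 by (simp add: K_def norm_mult power_mult_distrib)
  qed
  have K0: "K t \<ge> 0" for t unfolding eK using zw d by (intro divide_nonneg_nonneg zero_le_power2) linarith
  have g0: "Re (g u) \<ge> 0" if "norm u \<le> 1" for u
    unfolding g_def using re[OF zu[OF that]] L by (rule Re_divide_add_of_real(1))
  have h0: "h t \<ge> 0" for t unfolding h_def by (intro mult_nonneg_nonneg g0 K0) (simp add: ne)
  have "((\<lambda>t. g (e t) * of_real (K t)) has_integral g v) {0..1}"
    by (simp only: e_def K_def has_integral_Poisson_unit_circle[OF holg v1])
  then have "((\<lambda>t. Re (g (e t) * of_real (K t))) has_integral Re (g v)) {0..1}"
    by (rule has_integral_Re)
  moreover have "(\<lambda>t. Re (g (e t) * of_real (K t))) = h"
    by (simp add: fun_eq_iff h_def)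
  ultimately have hi: "(h has_integral Re (g v)) {0..1}"
    by simp
  have cont: "continuous_on UNIV h"
  proof -
    have "continuous_on UNIV (\<lambda>t. g (e t))"
      using ne by (intro continuous_on_compose2[OF holomorphic_on_imp_continuous_on[OF holg]]) 
        (auto simp: e_def intro!: continuous_intros)
    moreover have "e t \<noteq> v" for t using ne[of t] v1 by auto
    ultimately show ?thesis
      unfolding h_def K_def e_def by (intro continuous_intros) auto
  qed
  then have hm[measurable]: "h \<in> borel_measurable borel" by (rule borel_measurable_continuous_onI)
  have nni: "(\<integral>\<^sup>+t\<in>{0..1}. ennreal (h t) \<partial>lborel) = ennreal (Re (g v))"
  proof -
    have "(\<integral>\<^sup>+t. ennreal (indicator {0..1} t * h t) \<partial>lborel) = ennreal (Re (g v))"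
    proof (rule nn_integral_has_integral_lborel)
      have "(\<lambda>t. indicator {0..1} t * h t) = (\<lambda>t. if t \<in> {0..1} then h t else 0)"
        by (auto simp: indicator_def)
      then show "((\<lambda>t. indicator {0..1} t * h t) has_integral Re (g v)) UNIV"
        using hi by (simp only: has_integral_restrict_UNIV)
    qed (use h0 in auto)
    then show ?thesis
      by (simp add: nn_integral_set_ennreal mult.commute)
  qed
  have gv: "Re (g v) \<le> 2 / L"
  proof -
    have "z * v = w" using z0 by (simp add: v_def)
    then show ?thesis
      using Re_divide_add_of_real(2)[OF re[OF w(1)] L] w by (simp add: g_def)
  qed
  have pt: "indicator (E w L) (z * e t) \<le> ennreal (200 * d) * ennreal (h t)" for t
  proof (cases "z * e t \<in> E w L")
    case True
    then have fz: "norm (f (z * e t)) > L" and dz: "norm (z * e t - w) \<le> 5 * d"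
      by (auto simp: E_def d_def dist_norm norm_minus_commute)
    have "Re (g (e t)) \<ge> 1 / 4"
      unfolding g_def using re[OF zu] ne L fz by (intro Re_divide_add_of_real(3)) auto
    \<comment> \<open>The numerator of the kernel is at least \<open>d / 2\<close>, and membership
      in \<open>E w L\<close> bounds its denominator by \<open>(5 * d)^2\<close>. Together with the
      factor 1/4 from \<open>Re (g (e t))\<close> this yields \<open>1 / (200 * d)\<close>.\<close>
    moreover have "K t \<ge> 1 / (50 * d)"
    proof -
      have "z * e t \<noteq> w" using \<open>norm w < norm z\<close> ne[of t] by (auto simp: norm_mult)
      then have "(d / 2) / (5 * d)\<^sup>2 \<le> K t"
        unfolding eK using zw d dz \<open>norm w < norm z\<close> by (intro frac_le power_mono) auto
      moreover have "(d / 2) / (5 * d)\<^sup>2 = 1 / (50 * d)" using d by (simp add: power2_eq_square)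
      ultimately show ?thesis by simp
    qed
    ultimately have "1 / 4 * (1 / (50 * d)) \<le> h t"
      unfolding h_def using d by (intro mult_mono) auto
    then have "200 * d * (1 / 4 * (1 / (50 * d))) \<le> 200 * d * h t"
      using d by (intro mult_left_mono) auto
    then have "1 \<le> 200 * d * h t" using d by simp
    then have "ennreal 1 \<le> ennreal (200 * d * h t)" by (rule ennreal_leI)
    then show ?thesis using True d h0[of t] by (simp add: ennreal_mult)
  qed auto
  have "(\<integral>\<^sup>+t\<in>{0..1}. indicator (E w L) (z * e t) \<partial>lborel) \<le> (\<integral>\<^sup>+t. ennreal (200 * d) * (ennreal (h t) * indicator {0..1} t) \<partial>lborel)"
    using pt by (intro nn_integral_mono) (auto simp: indicator_def)
  also have "\<dots> = ennreal (200 * d) * ennreal (Re (g v))"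
    by (subst nn_integral_cmult) (auto simp: nni)
  also have "\<dots> = ennreal (200 * d * Re (g v))"
    using d g0[of v] v1 by (simp add: ennreal_mult)
  also have "\<dots> \<le> ennreal (200 * d * (2 / L))"
    using d gv by (intro ennreal_leI mult_left_mono) auto
  finally show ?thesis by (simp add: e_def d_def)
qed

text \<open>Two gains multiply. With \<open>d = 1 - |w|\<close>, the set lies in an annulus whose
  weight integral is of order \<open>(d / L) powr (\<alpha> + 1)\<close>, and it occupies at most a
  proportion \<open>400 * d / L\<close> of every circle in that annulus.\<close>

lemma half_plane_local_weak_type:
  fixes \<alpha> :: real
  assumes \<alpha>: "\<alpha> > -1"
  obtains C where "C > 0"
    "\<And>f w L. f holomorphic_on \<D> \<Longrightarrow> (\<And>z. norm z < 1 \<Longrightarrow> 0 < Re (f z)) \<Longrightarrow>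
       norm w < 1 \<Longrightarrow> norm (f w) = 2 \<Longrightarrow> L \<ge> 784 \<Longrightarrow>
       emeasure \<A>\<^bsub>\<alpha>\<^esub> ({z \<in> \<D>. norm (f z) > L} \<inter> cball w (5 * (1 - norm w)))
         \<le> ennreal (C * ((1 - norm w) / L) powr (\<alpha> + 2))"
proof -
  obtain C\<^sub>0 where C0: "C\<^sub>0 > 0" "\<And>\<eta>. \<eta> > 0 \<Longrightarrow>
    (\<integral>\<^sup>+z\<in>{z::complex. 0 < 1 - (norm z)\<^sup>2 \<and> 1 - (norm z)\<^sup>2 < \<eta>}. ennreal ((1 - (norm z)\<^sup>2) powr \<alpha>) \<partial>lborel)
      \<le> ennreal (C\<^sub>0 * \<eta> powr (\<alpha> + 1))"
  proof (rule nn_integral_weight_annulus_le[OF \<alpha>], goal_cases)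
    case (1 C)
    show ?case by (rule 1(1)) (fact 1(2-))+
  qed
  define C where "C = (\<alpha> + 1) / pi * (400 * (C\<^sub>0 * 392 powr (\<alpha> + 1)))"
  have "emeasure \<A>\<^bsub>\<alpha>\<^esub> ({z \<in> \<D>. norm (f z) > L} \<inter> cball w (5 * (1 - norm w)))
         \<le> ennreal (C * ((1 - norm w) / L) powr (\<alpha> + 2))"
    if holf: "f holomorphic_on \<D>" and re: "\<And>z. norm z < 1 \<Longrightarrow> 0 < Re (f z)"
      and w: "norm w < 1" "norm (f w) = 2" and L: "L \<ge> 784" for f w L
  proof -
    define d where "d = 1 - norm w"
    define \<eta> where "\<eta> = 392 * d / L"
    have d: "d > 0" using w by (simp add: d_def)
    \<comment> \<open>The threshold \<open>784 = 2 * 392\<close> makes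
      \<open>\<eta> \<le> d / 2\<close>, so every circle in the annulus \<open>?A\<close> satisfies
      the hypothesis of the circle estimate.\<close>
    have \<eta>: "0 < \<eta>" "\<eta> \<le> d / 2"
    proof -
      show "0 < \<eta>" using d L by (simp add: \<eta>_def)
      have "d * 784 \<le> d * L" using d L by (intro mult_left_mono) auto
      then show "\<eta> \<le> d / 2" using L by (simp add: \<eta>_def field_simps)
    qed
    let ?E = "{z \<in> \<D>. norm (f z) > L} \<inter> cball w (5 * (1 - norm w))"
    let ?A = "{z::complex. 0 < 1 - (norm z)\<^sup>2 \<and> 1 - (norm z)\<^sup>2 < \<eta>}"
    \<comment> \<open>Building the annulus into the weight keeps it rotation invariant and restricts
      the circle estimate to the circles where it holds.\<close>
    let ?W = "\<lambda>z::complex. ennreal ((1 - (norm z)\<^sup>2) powr \<alpha>) * indicator ?A z"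
    have "{z \<in> \<D>. f z \<in> {u. norm u > L}} \<in> sets borel"
      using holf by (intro sets_borel_vimage_continuous_on holomorphic_on_imp_continuous_on) auto
    then have E[measurable]: "?E \<in> sets borel" by auto
    have EA: "?E \<subseteq> ?A"
    proof
      fix z assume z: "z \<in> ?E"
      then have z1: "norm z < 1" by simp
      then have "0 < 1 - (norm z)\<^sup>2" by (simp add: abs_square_less_1)
      moreover have "1 - (norm z)\<^sup>2 < \<eta>"
        unfolding \<eta>_def d_def using z L z1
        by (intro half_plane_large_near_boundary[OF holf re w]) (auto simp: dist_norm norm_minus_commute)
      ultimately show "z \<in> ?A" by simp
    qed
    have "(\<integral>\<^sup>+z\<in>?E. ennreal ((1 - (norm z)\<^sup>2) powr \<alpha>) \<partial>lborel) = (\<integral>\<^sup>+z. ?W z * indicator ?E z \<partial>lborel)"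
      using EA by (intro nn_integral_cong) (auto simp: indicator_def)
    also have "\<dots> \<le> ennreal (400 * d / L) * (\<integral>\<^sup>+z. ?W z \<partial>lborel)"
    proof (rule nn_integral_indicator_le_circle_mean)
      fix z assume "?W z \<noteq> 0"
      then have z: "0 < 1 - (norm z)\<^sup>2" "1 - (norm z)\<^sup>2 < \<eta>" by (auto simp: indicator_def split: if_splits)
      show "(\<integral>\<^sup>+t\<in>{0..1}. indicator ?E (z * exp (2 * of_real pi * \<i> * of_real t)) \<partial>lborel) \<le> ennreal (400 * d / L)"
        unfolding d_def
      proof (rule half_plane_circle_mean_le[OF holf re w])
        show "L > 0" using L by simp
        show "norm z < 1" using z(1) by (simp add: abs_square_less_1)
        show "1 - (norm z)\<^sup>2 \<le> (1 - norm w) / 2"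
          using less_le_trans[OF z(2) \<eta>(2)] unfolding d_def by (rule less_imp_le)
      qed
    next
      show "?W \<in> borel_measurable borel" by measurable
    next
      show "?W (c * z) = ?W z" if "norm c = 1" for z c
        using that by (simp add: norm_mult indicator_def)
    qed (rule E)
    also have "\<dots> \<le> ennreal (400 * d / L) * ennreal (C\<^sub>0 * \<eta> powr (\<alpha> + 1))"
      by (rule mult_left_mono[OF C0(2)[OF \<eta>(1)]]) simp
    also have "\<dots> = ennreal (400 * d / L * (C\<^sub>0 * \<eta> powr (\<alpha> + 1)))"
      using C0(1) by (intro ennreal_mult''[symmetric]) simp
    finally have int: "(\<integral>\<^sup>+z\<in>?E. ennreal ((1 - (norm z)\<^sup>2) powr \<alpha>) \<partial>lborel)
      \<le> ennreal (400 * d / L * (C\<^sub>0 * \<eta> powr (\<alpha> + 1)))" .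
    have eq: "400 * d / L * (C\<^sub>0 * \<eta> powr (\<alpha> + 1)) = 400 * (C\<^sub>0 * 392 powr (\<alpha> + 1)) * (d / L) powr (\<alpha> + 2)"
    proof -
      have dL: "d / L > 0" using d L by simp
      have "\<eta> powr (\<alpha> + 1) = 392 powr (\<alpha> + 1) * (d / L) powr (\<alpha> + 1)"
        using dL powr_mult[of 392 "d / L" "\<alpha> + 1"] by (simp add: \<eta>_def)
      moreover have "(d / L) powr (\<alpha> + 2) = (d / L) powr (\<alpha> + 1) * (d / L)"
        using dL d L powr_add[of "d / L" "\<alpha> + 1" 1] by (simp add: add.assoc)
      ultimately show ?thesis by simp
    qed
    have "emeasure \<A>\<^bsub>\<alpha>\<^esub> ?E = ennreal ((\<alpha> + 1) / pi) * (\<integral>\<^sup>+z\<in>?E. ennreal ((1 - (norm z)\<^sup>2) powr \<alpha>) \<partial>lborel)"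
      by (rule emeasure_weighted_disc_area[OF \<alpha> E]) auto
    also have "\<dots> \<le> ennreal ((\<alpha> + 1) / pi) * ennreal (400 * d / L * (C\<^sub>0 * \<eta> powr (\<alpha> + 1)))"
      by (rule mult_left_mono[OF int]) simp
    also have "\<dots> = ennreal ((\<alpha> + 1) / pi * (400 * (C\<^sub>0 * 392 powr (\<alpha> + 1)) * (d / L) powr (\<alpha> + 2)))"
      unfolding eq using C0(1) by (intro ennreal_mult''[symmetric]) simp
    finally show ?thesis by (simp only: C_def d_def mult.assoc)
  qed
  moreover have "C > 0" using C0 \<alpha> by (simp add: C_def)
  ultimately show thesis using that by blast
qed

lemma half_plane_weak_type:
  fixes \<alpha> :: real
  assumes \<alpha>: "\<alpha> > -1"
  obtains C where "C > 0"
    "\<And>f L. f holomorphic_on \<D> \<Longrightarrow> (\<And>z. norm z < 1 \<Longrightarrow> 0 < Re (f z)) \<Longrightarrow>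
       norm (f 0) < 2 \<Longrightarrow> L \<ge> 784 \<Longrightarrow>
       emeasure \<A>\<^bsub>\<alpha>\<^esub> {z \<in> \<D>. norm (f z) > L}
         \<le> ennreal (C * L powr - (\<alpha> + 2)) * emeasure \<A>\<^bsub>\<alpha>\<^esub> {z \<in> \<D>. norm (f z) > 1}"
proof -
  obtain C\<^sub>1 where C1: "C\<^sub>1 > 0"
    "\<And>f w L. f holomorphic_on \<D> \<Longrightarrow> (\<And>z. norm z < 1 \<Longrightarrow> 0 < Re (f z)) \<Longrightarrow>
       norm w < 1 \<Longrightarrow> norm (f w) = 2 \<Longrightarrow> L \<ge> 784 \<Longrightarrow>
       emeasure \<A>\<^bsub>\<alpha>\<^esub> ({z \<in> \<D>. norm (f z) > L} \<inter> cball w (5 * (1 - norm w)))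
         \<le> ennreal (C\<^sub>1 * ((1 - norm w) / L) powr (\<alpha> + 2))"
  proof (rule half_plane_local_weak_type[OF \<alpha>], goal_cases)
    case (1 C)
    show ?case by (rule 1(1)) (fact 1(2-))+
  qed
  obtain c where c: "c > 0" "\<And>w. w \<in> \<D> \<Longrightarrow>
    ennreal (c * (1 - norm w) powr (\<alpha> + 2)) \<le> emeasure \<A>\<^bsub>\<alpha>\<^esub> (cball w ((1 - norm w) / 4))"
  proof (rule emeasure_weighted_disc_area_cball_ge[OF \<alpha>], goal_cases)
    case (1 C)
    show ?case by (rule 1(1)) (fact 1(2-))+
  qed
  have "emeasure \<A>\<^bsub>\<alpha>\<^esub> {z \<in> \<D>. norm (f z) > L}
         \<le> ennreal (C\<^sub>1 / c * L powr - (\<alpha> + 2)) * emeasure \<A>\<^bsub>\<alpha>\<^esub> {z \<in> \<D>. norm (f z) > 1}"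
    if holf: "f holomorphic_on \<D>" and re: "\<And>z. norm z < 1 \<Longrightarrow> 0 < Re (f z)"
      and f0: "norm (f 0) < 2" and L: "L \<ge> 784" for f L
  proof -
    let ?S = "\<lambda>s. {z \<in> \<D>. norm (f z) > s}"
    let ?k = "ennreal (C\<^sub>1 / c * L powr - (\<alpha> + 2))"
    define K where "K = {w \<in> \<D>. norm (f w) = 2}"
    have contf: "continuous_on \<D> f" using holf by (rule holomorphic_on_imp_continuous_on)
    have Sborel: "?S s \<in> sets borel" for s
      using sets_borel_vimage_continuous_on[OF contf, of "{u. norm u > s}"] by simp
    have cover: "?S L \<subseteq> (\<Union>w\<in>K. cball w (1 - norm w))"
    proof
      fix z assume z: "z \<in> ?S L"
      have tz: "of_real t * z \<in> \<D>" if "0 \<le> t" "t \<le> 1" for t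
      proof -
        have "t * norm z \<le> 1 * norm z" using that by (intro mult_right_mono) auto
        then show ?thesis using z that by (simp add: norm_mult)
      qed
      \<comment> \<open>Along the radius \<open>|f|\<close> passes from \<open>|f 0| < 2\<close> to
        \<open>|f z| > L\<close>, with \<open>L > 2\<close>, so it takes the value 2 in
        between.\<close>
      have "continuous_on {0..1} (\<lambda>t. norm (f (of_real t * z)))"
        using tz by (intro continuous_intros continuous_on_compose2[OF contf]) auto
      then have "\<exists>t\<ge>0. t \<le> 1 \<and> norm (f (of_real t * z)) = 2"
        using f0 z L by (intro IVT') auto
      then obtain t where t: "0 \<le> t" "t \<le> 1" "norm (f (of_real t * z)) = 2" by blast
      \<comment> \<open>Both points lie on one radius, so their distance is the difference of their
        moduli, which is below \<open>1 - |t * z|\<close>.\<close>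
      have "dist (of_real t * z) z = norm ((of_real t - 1) * z)"
        by (simp add: dist_norm algebra_simps)
      also have "\<dots> = \<bar>t - 1\<bar> * norm z"
        by (metis norm_mult norm_of_real of_real_1 of_real_diff)
      also have "\<dots> = norm z - norm (of_real t * z)"
        using t by (simp add: norm_mult algebra_simps)
      finally have "dist (of_real t * z) z \<le> 1 - norm (of_real t * z)"
        using z by simp
      moreover have "of_real t * z \<in> K" using t tz by (simp add: K_def)
      ultimately show "z \<in> (\<Union>w\<in>K. cball w (1 - norm w))" by (intro UN_I) auto
    qed
    have rK: "0 < 1 - norm w \<and> 1 - norm w \<le> 1" if "w \<in> K" for w
      using that by (simp add: K_def)
    obtain I where I: "countable I" "I \<subseteq> K"
      "pairwise (\<lambda>i j. disjnt (cball i (1 - norm i)) (cball j (1 - norm j))) I"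
      "?S L \<subseteq> (\<Union>i\<in>I. cball i (5 * (1 - norm i)))"
    proof (rule Vitali_covering_lemma_cballs[where B = 1, OF cover], goal_cases)
        case (1 w)
        then show ?case by (intro rK)
      next
        case (2 I)
        show ?case by (rule 2(1)) (fact 2(2-))+
      qed
    \<comment> \<open>\<open>I\<close> may be finite, so it is indexed by a set \<open>J\<close> of naturals, padded with empty sets.\<close>
    define J where "J = to_nat_on I ` I"
    define w where "w n = from_nat_into I n" for n
    have wI: "w n \<in> I" if "n \<in> J" for n
      using that I(1) by (auto simp: J_def w_def)
    have wonto: "\<exists>n\<in>J. w n = i" if "i \<in> I" for i
      using that I(1) by (auto simp: J_def w_def)
    have winj: "m = n" if "m \<in> J" "n \<in> J" "w m = w n" for m n
      using that I(1) by (auto simp: J_def w_def)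
    define F where "F n = (if n \<in> J then ?S L \<inter> cball (w n) (5 * (1 - norm (w n))) else {})" for n
    define D where "D n = (if n \<in> J then cball (w n) ((1 - norm (w n)) / 4) else {})" for n
    have wD: "w n \<in> \<D>" "norm (w n) < 1" "norm (f (w n)) = 2" if "n \<in> J" for n
      using wI[OF that] I(2) by (auto simp: K_def)
    have DS: "D n \<subseteq> ?S 1" for n
      using half_plane_large_on_cball[OF holf re wD(2) wD(3)] by (auto simp: D_def)
    have FD: "emeasure \<A>\<^bsub>\<alpha>\<^esub> (F n) \<le> ?k * emeasure \<A>\<^bsub>\<alpha>\<^esub> (D n)" for n
    proof (cases "n \<in> J")
      case True
      define d where "d = 1 - norm (w n)"
      have d: "d > 0" using wD[OF True] by (simp add: d_def)
      have "emeasure \<A>\<^bsub>\<alpha>\<^esub> (F n) \<le> ennreal (C\<^sub>1 * (d / L) powr (\<alpha> + 2))"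
        using C1(2)[OF holf re wD(2,3)[OF True] L] True by (simp add: F_def d_def)
      \<comment> \<open>Both the upper bound for \<open>F n\<close> and the lower bound for
        \<open>D n\<close> are proportional to \<open>d powr (\<alpha> + 2)\<close>. Their ratio is
        thus the same for all \<open>n\<close>, which allows summation over the disjoint sets
        \<open>D n\<close>.\<close>
      also have "C\<^sub>1 * (d / L) powr (\<alpha> + 2) = C\<^sub>1 / c * L powr - (\<alpha> + 2) * (c * d powr (\<alpha> + 2))"
      proof -
        have "(d / L) powr (\<alpha> + 2) = d powr (\<alpha> + 2) / L powr (\<alpha> + 2)"
          by (rule powr_divide)
        also have "\<dots> = L powr - (\<alpha> + 2) * d powr (\<alpha> + 2)"
          unfolding powr_minus divide_inverse by (rule mult.commute)
        finally show ?thesis using c(1) by simp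
      qed
      also have "ennreal \<dots> = ?k * ennreal (c * d powr (\<alpha> + 2))"
        using c(1) by (intro ennreal_mult'') simp
      also have "\<dots> \<le> ?k * emeasure \<A>\<^bsub>\<alpha>\<^esub> (D n)"
        using c(2)[OF wD(1)[OF True]] True by (intro mult_left_mono) (simp_all add: D_def d_def)
      finally show ?thesis .
    qed (simp add: F_def D_def)
    have Dsets: "range D \<subseteq> sets \<A>\<^bsub>\<alpha>\<^esub>"
    proof -
      have "D n \<in> sets borel" for n by (simp add: D_def)
      moreover have "D n \<subseteq> \<D>" for n using DS[of n] by auto
      ultimately show ?thesis by (auto intro: sets_weighted_disc_areaI)
    qed
    have Fsets: "range F \<subseteq> sets \<A>\<^bsub>\<alpha>\<^esub>"
    proof -
      have "F n \<in> sets borel" for n using Sborel[of L] by (simp only: F_def) (auto intro: sets.Int)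
      moreover have "F n \<subseteq> \<D>" for n by (auto simp: F_def)
      ultimately show ?thesis by (auto intro: sets_weighted_disc_areaI)
    qed
    have disj: "disjoint_family D"
    proof (unfold disjoint_family_on_def, intro ballI impI)
      fix m n :: nat assume "m \<noteq> n"
      show "D m \<inter> D n = {}"
      proof (cases "m \<in> J \<and> n \<in> J")
        case True
        then have "w m \<noteq> w n" using winj \<open>m \<noteq> n\<close> by blast
        then have "disjnt (cball (w m) (1 - norm (w m))) (cball (w n) (1 - norm (w n)))"
          using I(3) wI True by (auto simp: pairwise_def)
        moreover have "D k \<subseteq> cball (w k) (1 - norm (w k))" if "k \<in> J" for k
          using that wD(2)[OF that] by (auto simp: D_def)
        ultimately show ?thesis using True unfolding disjnt_def by blast
      qed (auto simp: D_def)
    qed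
    have "?S L \<subseteq> (\<Union>n. F n)"
    proof
      fix z assume z: "z \<in> ?S L"
      then obtain i where "i \<in> I" "z \<in> cball i (5 * (1 - norm i))" using I(4) by blast
      then obtain n where "n \<in> J" "w n = i" using wonto by blast
      then have "z \<in> F n" using z \<open>z \<in> cball i _\<close> by (simp add: F_def)
      then show "z \<in> (\<Union>n. F n)" by blast
    qed
    then have "emeasure \<A>\<^bsub>\<alpha>\<^esub> (?S L) \<le> emeasure \<A>\<^bsub>\<alpha>\<^esub> (\<Union>n. F n)"
      using Fsets by (intro emeasure_mono) auto
    also have "\<dots> \<le> (\<Sum>n. emeasure \<A>\<^bsub>\<alpha>\<^esub> (F n))"
      by (rule emeasure_subadditive_countably[OF Fsets])
    also have "\<dots> \<le> (\<Sum>n. ?k * emeasure \<A>\<^bsub>\<alpha>\<^esub> (D n))"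
      by (intro suminf_le FD) auto
    also have "\<dots> = ?k * emeasure \<A>\<^bsub>\<alpha>\<^esub> (\<Union>n. D n)"
      unfolding ennreal_suminf_cmult suminf_emeasure[OF Dsets disj] ..
    also have "\<dots> \<le> ?k * emeasure \<A>\<^bsub>\<alpha>\<^esub> (?S 1)"
    proof (intro mult_left_mono emeasure_mono)
      show "?S 1 \<in> sets \<A>\<^bsub>\<alpha>\<^esub>" by (rule sets_weighted_disc_areaI[OF Sborel]) auto
    qed (use DS in auto)
    finally show ?thesis .
  qed
  moreover have "C\<^sub>1 / c > 0" using C1(1) c(1) by simp
  ultimately show thesis using that by blast
qed

section \<open>Carleson windows\<close>

text \<open>For \<open>u = z * cnj \<xi>\<close>, split \<open>1 - u\<close> into the radial part
  \<open>1 - |u|\<close> and the angular part \<open>|u| * (1 - exp (\<i> * Arg u))\<close>. Each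
  has modulus at most \<open>h\<close>, the second because a chord is no longer than its
  arc.\<close>

lemma norm_one_minus_le_of_carleson_window:
  assumes \<xi>: "norm \<xi> = 1" and h: "h < 1" and z: "z \<in> carleson_window \<xi> h"
  shows "norm (1 - z * cnj \<xi>) \<le> 2 * h"
proof -
  define u where "u = z * cnj \<xi>"
  have u: "norm u < 1" "1 - h \<le> norm u" "\<bar>Arg u\<bar> \<le> h"
    using z \<xi> by (auto simp: carleson_window_def u_def norm_mult)
  have ue: "u = of_real (norm u) * exp (\<i> * of_real (Arg u))"
    by (metis rcis_cmod_Arg rcis_def cis_conv_exp)
  have "norm (1 - exp (\<i> * of_real (Arg u))) = 2 * \<bar>sin (Arg u / 2)\<bar>"
    by (metis dist_exp_i_1 norm_minus_commute)
  also have "\<dots> \<le> h"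
    using abs_sin_x_le_abs_x[of "Arg u / 2"] u(3) by simp
  finally have e: "norm (1 - exp (\<i> * of_real (Arg u))) \<le> h" .
  have "1 - u = (1 - of_real (norm u)) + of_real (norm u) * (1 - exp (\<i> * of_real (Arg u)))"
    by (subst (1) ue) (simp add: algebra_simps)
  then have "norm (1 - u) \<le> norm (1 - of_real (norm u) :: complex) + norm u * norm (1 - exp (\<i> * of_real (Arg u)))"
    by (metis norm_triangle_ineq norm_mult norm_of_real abs_norm_cancel)
  also have "norm (1 - of_real (norm u) :: complex) = 1 - norm u"
    using u(1) by (metis abs_of_pos diff_gt_0_iff_gt norm_of_real of_real_1 of_real_diff)
  also have "1 - norm u + norm u * norm (1 - exp (\<i> * of_real (Arg u))) \<le> h + 1 * h"
    using u e by (intro add_mono mult_mono) auto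
  finally show ?thesis by (simp add: u_def)
qed

text \<open>The argument of \<open>u = z * cnj \<xi>\<close> is the imaginary part of
  \<open>Ln u\<close>, and \<open>|Ln u| \<le> 2 * |u - 1|\<close> near 1. The modulus condition is
  the triangle inequality.\<close>

lemma carleson_window_of_norm_one_minus_less:
  assumes \<xi>: "norm \<xi> = 1" and h: "0 < h" "h < 1" and z: "norm z < 1" "norm (1 - z * cnj \<xi>) < h / 4"
  shows "z \<in> carleson_window \<xi> h"
proof -
  define u where "u = z * cnj \<xi>"
  have u: "norm (u - 1) < h / 4" "norm u = norm z"
    using z \<xi> by (simp_all add: u_def norm_minus_commute norm_mult)
  have nu: "norm z \<ge> 1 - h" 
    using norm_triangle_ineq2[of 1 "1 - u"] u h by (simp add: norm_minus_commute)
  then have u0: "u \<noteq> 0" using u(2) h by auto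
  have "\<bar>Arg u\<bar> \<le> norm (Ln u)"
    unfolding Arg_eq_Im_Ln[OF u0] by (rule abs_Im_le_cmod)
  also have "\<dots> \<le> 2 * norm (u - 1)"
    using norm_Ln_le[of "u - 1"] u h by simp
  also have "\<dots> \<le> h" using u(1) h(1) by simp
  finally show ?thesis using nu z by (simp add: carleson_window_def u_def)
qed

text \<open>The cosine is decreasing on \<open>{0..pi}\<close>, so the bound on the discontinuous
  \<open>Arg\<close> becomes an inequality between continuous functions. This presents the window as
  the disc intersected with a closed set, hence as a Borel set.\<close>

lemma carleson_window_conv_cos:
  assumes \<xi>: "norm \<xi> = 1" and h: "0 < h" "h < 1"
  shows "carleson_window \<xi> h = {z \<in> \<D>. 1 - h \<le> norm z \<and> cos h * norm z \<le> Re (z * cnj \<xi>)}"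
proof -
  have "\<bar>Arg (z * cnj \<xi>)\<bar> \<le> h \<longleftrightarrow> cos h * norm z \<le> Re (z * cnj \<xi>)" if "1 - h \<le> norm z" for z
  proof -
    define u where "u = z * cnj \<xi>"
    have nu: "norm u = norm z" "norm z > 0" using \<xi> that h by (auto simp: u_def norm_mult)
    have "Re u = norm u * cos (Arg u)" by (metis rcis_cmod_Arg Re_rcis)
    then have "cos h * norm z \<le> Re u \<longleftrightarrow> cos h \<le> cos \<bar>Arg u\<bar>"
      using nu by (simp add: mult.commute)
    also have "\<dots> \<longleftrightarrow> \<bar>Arg u\<bar> \<le> h"
      using h pi_gt3 Arg_bounded[of u] by (intro cos_mono_le_eq) auto
    finally show ?thesis by (simp add: u_def)
  qed
  then show ?thesis by (auto simp: carleson_window_def)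
qed

lemma sets_borel_carleson_window:
  assumes "norm \<xi> = 1" "0 < h" "h < 1"
  shows "carleson_window \<xi> h \<in> sets borel"
proof -
  have "{z::complex. 1 - h \<le> norm z \<and> cos h * norm z \<le> Re (z * cnj \<xi>)} \<in> sets borel"
    by (intro borel_closed closed_Collect_conj closed_Collect_le continuous_intros)
  then have "\<D> \<inter> {z::complex. 1 - h \<le> norm z \<and> cos h * norm z \<le> Re (z * cnj \<xi>)} \<in> sets borel"
    by (intro sets.Int) auto
  then show ?thesis
    unfolding carleson_window_conv_cos[OF assms] by (simp add: Int_def)
qed

section \<open>Reduction of the theorem to the weak-type estimate\<close>

theorem theorem1p1:
  fixes \<alpha> :: real
  assumes "\<alpha> > -1"
  shows "\<exists>C::real. C > 0 \<and>
    (\<forall>\<phi> :: complex \<Rightarrow> complex. \<phi> analytic_on \<D> \<and> \<phi> ` \<D> \<subseteq> \<D> \<longrightarrow>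
      (\<exists>h\<^sub>0::real. 0 < h\<^sub>0 \<and> h\<^sub>0 < 1 \<and>
        (\<forall>h::real. \<forall>\<epsilon>::real. \<forall>\<xi>::complex.
          0 < h \<and> h < h\<^sub>0 \<and> 0 < \<epsilon> \<and> \<epsilon> < 1 \<and> \<xi> \<in> \<T> \<longrightarrow>
          emeasure \<A>\<^bsub>\<alpha>\<^esub> {z \<in> \<D>. \<phi> z \<in> carleson_window \<xi> (\<epsilon> * h)}
            \<le> ennreal (C * \<epsilon> powr (\<alpha> + 2)) *
              emeasure \<A>\<^bsub>\<alpha>\<^esub> {z \<in> \<D>. \<phi> z \<in> carleson_window \<xi> h})))"
proof -
  obtain K where K: "K > 0"
    "\<And>f L. f holomorphic_on \<D> \<Longrightarrow> (\<And>z. norm z < 1 \<Longrightarrow> 0 < Re (f z)) \<Longrightarrow>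
       norm (f 0) < 2 \<Longrightarrow> L \<ge> 784 \<Longrightarrow>
       emeasure \<A>\<^bsub>\<alpha>\<^esub> {z \<in> \<D>. norm (f z) > L}
         \<le> ennreal (K * L powr - (\<alpha> + 2)) * emeasure \<A>\<^bsub>\<alpha>\<^esub> {z \<in> \<D>. norm (f z) > 1}"
  proof (rule half_plane_weak_type[OF assms], goal_cases)
    case (1 C)
    show ?case by (rule 1(1)) (fact 1(2-))+
  qed
  \<comment> \<open>One summand for each regime of \<open>\<epsilon>\<close>. The weak-type bound
    with \<open>L = 1 / (16 * \<epsilon>)\<close> requires \<open>L \<ge> 784\<close>; otherwise
    \<open>\<epsilon> > 1 / 12544\<close>, where \<open>12544 = 16 * 784\<close>, and then
    \<open>C * \<epsilon> powr (\<alpha> + 2) \<ge> 1\<close>, so inclusion of the windows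
    suffices.\<close>
  define C where "C = K * 16 powr (\<alpha> + 2) + 12544 powr (\<alpha> + 2)"
  have C: "C > 0" "K * 16 powr (\<alpha> + 2) \<le> C" "12544 powr (\<alpha> + 2) \<le> C"
    using K(1) by (simp_all add: C_def add_pos_pos)
  \<comment> \<open>The threshold \<open>(1 - |\<phi> 0|) / 2\<close> for \<open>h\<close> depends
    on \<open>\<phi>\<close> only through \<open>\<phi> 0\<close>. It ensures \<open>h < 1\<close>
    and, for the function \<open>f\<close> below, \<open>|f 0| < 2\<close>, uniformly in
    \<open>\<xi>\<close> and \<open>\<epsilon>\<close>.\<close>
  have main: "emeasure \<A>\<^bsub>\<alpha>\<^esub> {z \<in> \<D>. \<phi> z \<in> carleson_window \<xi> (\<epsilon> * h)}
            \<le> ennreal (C * \<epsilon> powr (\<alpha> + 2)) *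
              emeasure \<A>\<^bsub>\<alpha>\<^esub> {z \<in> \<D>. \<phi> z \<in> carleson_window \<xi> h}"
    if an: "\<phi> analytic_on \<D>" and im: "\<phi> ` \<D> \<subseteq> \<D>" and h: "0 < h" "h < (1 - norm (\<phi> 0)) / 2"
      and \<epsilon>: "0 < \<epsilon>" "\<epsilon> < 1" and \<xi>: "norm \<xi> = 1" for \<phi> h \<epsilon> \<xi>
  proof -
    have hol\<phi>: "\<phi> holomorphic_on \<D>" using an by (rule analytic_imp_holomorphic)
    have "(1 - norm (\<phi> 0)) / 2 < 1" by (rule order_le_less_trans[of _ "1 / 2"]) simp_all
    with h(2) have h1: "h < 1" by (rule less_trans)
    have \<epsilon>h: "\<epsilon> * h \<le> h" using \<epsilon> h mult_right_mono[of \<epsilon> 1 h] by simp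
    have \<phi>1: "norm (\<phi> z) < 1" if "norm z < 1" for z
      using im that by (simp add: image_subset_iff)
    have sW: "{z \<in> \<D>. \<phi> z \<in> carleson_window \<xi> h} \<in> sets \<A>\<^bsub>\<alpha>\<^esub>"
      using sets_borel_carleson_window[OF \<xi> h(1) h1] hol\<phi>
      by (intro sets_weighted_disc_areaI sets_borel_vimage_continuous_on holomorphic_on_imp_continuous_on) auto
    show ?thesis
    proof (cases "1 / (16 * \<epsilon>) \<ge> 784")
      case False
      have "1 \<le> 12544 * \<epsilon>" using False \<epsilon> by (simp add: field_simps)
      then have "1 powr (\<alpha> + 2) \<le> (12544 * \<epsilon>) powr (\<alpha> + 2)"
        using assms by (intro powr_mono2) auto
      also have "\<dots> = 12544 powr (\<alpha> + 2) * \<epsilon> powr (\<alpha> + 2)"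
        using \<epsilon> by (simp add: powr_mult)
      also have "\<dots> \<le> C * \<epsilon> powr (\<alpha> + 2)"
        using C(3) by (intro mult_right_mono) auto
      finally have one: "1 \<le> ennreal (C * \<epsilon> powr (\<alpha> + 2))"
        by (simp add: ennreal_ge_1)
      have "emeasure \<A>\<^bsub>\<alpha>\<^esub> {z \<in> \<D>. \<phi> z \<in> carleson_window \<xi> (\<epsilon> * h)} \<le> emeasure \<A>\<^bsub>\<alpha>\<^esub> {z \<in> \<D>. \<phi> z \<in> carleson_window \<xi> h}"
        using \<epsilon>h by (intro emeasure_mono sW) (auto simp: carleson_window_def)
      also have "\<dots> \<le> ennreal (C * \<epsilon> powr (\<alpha> + 2)) * emeasure \<A>\<^bsub>\<alpha>\<^esub> {z \<in> \<D>. \<phi> z \<in> carleson_window \<xi> h}"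
        using mult_right_mono[OF one] by simp
      finally show ?thesis .
    next
      case True
      \<comment> \<open>On the event for the smaller window \<open>|f|\<close> is at least
        \<open>1 / (8 * \<epsilon>)\<close>. Taking half of this as \<open>L\<close> makes the
        inequality \<open>|f| > L\<close> strict.\<close>
      define L where "L = 1 / (16 * \<epsilon>)"
      define f where "f z = of_real (h / 4) / (1 - \<phi> z * cnj \<xi>)" for z
      have u1: "norm (\<phi> z * cnj \<xi>) < 1" if "norm z < 1" for z
        using \<phi>1[OF that] \<xi> by (simp add: norm_mult)
      have Re1: "Re (1 - \<phi> z * cnj \<xi>) > 0" if "norm z < 1" for z
        using complex_Re_le_cmod[of "\<phi> z * cnj \<xi>"] u1[OF that] by simp
      have nz: "1 - \<phi> z * cnj \<xi> \<noteq> 0" if "norm z < 1" for z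
        using Re1[OF that] by force
      have holf: "f holomorphic_on \<D>"
        unfolding f_def using nz hol\<phi> by (intro holomorphic_intros) auto
      have re: "0 < Re (f z)" if "norm z < 1" for z
        unfolding f_def using Re1[OF that] nz[OF that] h(1)
        by (subst complex_div_cnj) (simp add: divide_pos_pos flip: of_real_power)
      have nf: "norm (f z) = h / 4 / norm (1 - \<phi> z * cnj \<xi>)" for z
        unfolding f_def norm_divide using h(1) by simp
      have f0: "norm (f 0) < 2"
      proof -
        have "norm (\<phi> 0 * cnj \<xi>) = norm (\<phi> 0)" using \<xi> by (simp add: norm_mult)
        then have "1 - norm (\<phi> 0) \<le> norm (1 - \<phi> 0 * cnj \<xi>)"
          using norm_triangle_ineq2[of 1 "\<phi> 0 * cnj \<xi>"] by simp
        moreover have "h * 2 < 1 - norm (\<phi> 0)" using h(2) by (simp only: less_divide_eq_numeral1)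
        ultimately have "h * 2 < norm (1 - \<phi> 0 * cnj \<xi>)" by simp
        with h(1) have "h < 2 * norm (1 - \<phi> 0 * cnj \<xi>)" by simp
        then show ?thesis
          unfolding nf using nz[of 0] h(1) by (simp add: divide_less_eq)
      qed
      have L: "L \<ge> 784" using True by (simp add: L_def)
      have w: "emeasure \<A>\<^bsub>\<alpha>\<^esub> {z \<in> \<D>. norm (f z) > L}
         \<le> ennreal (K * L powr - (\<alpha> + 2)) * emeasure \<A>\<^bsub>\<alpha>\<^esub> {z \<in> \<D>. norm (f z) > 1}"
      proof (rule K(2))
        show "f holomorphic_on \<D>" by (rule holf)
        show "0 < Re (f z)" if "norm z < 1" for z using that by (rule re)
      qed (fact f0 L)+
      have "{z \<in> \<D>. norm (f z) > L} \<in> sets \<A>\<^bsub>\<alpha>\<^esub>"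
        using sets_borel_vimage_continuous_on[OF holomorphic_on_imp_continuous_on[OF holf], of "{u. norm u > L}"]
        by (intro sets_weighted_disc_areaI) auto
      moreover have "{z \<in> \<D>. \<phi> z \<in> carleson_window \<xi> (\<epsilon> * h)} \<subseteq> {z \<in> \<D>. norm (f z) > L}"
      proof
        fix z assume z: "z \<in> {z \<in> \<D>. \<phi> z \<in> carleson_window \<xi> (\<epsilon> * h)}"
        then have z1: "norm z < 1" by simp
        have "norm (1 - \<phi> z * cnj \<xi>) \<le> 2 * (\<epsilon> * h)"
          using z \<epsilon>h h1 by (intro norm_one_minus_le_of_carleson_window[OF \<xi>]) auto
        then have "h / 4 / (2 * (\<epsilon> * h)) \<le> norm (f z)"
          unfolding nf using nz[OF z1] h(1) by (intro divide_left_mono mult_pos_pos) (use \<epsilon> in auto)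
        moreover have "L < h / 4 / (2 * (\<epsilon> * h))"
          using \<epsilon> h(1) by (simp add: L_def field_simps)
        ultimately show "z \<in> {z \<in> \<D>. norm (f z) > L}" using z1 by simp
      qed
      ultimately have "emeasure \<A>\<^bsub>\<alpha>\<^esub> {z \<in> \<D>. \<phi> z \<in> carleson_window \<xi> (\<epsilon> * h)} \<le> emeasure \<A>\<^bsub>\<alpha>\<^esub> {z \<in> \<D>. norm (f z) > L}"
        by (intro emeasure_mono)
      also note w
      also have "ennreal (K * L powr - (\<alpha> + 2)) * emeasure \<A>\<^bsub>\<alpha>\<^esub> {z \<in> \<D>. norm (f z) > 1}
        \<le> ennreal (C * \<epsilon> powr (\<alpha> + 2)) * emeasure \<A>\<^bsub>\<alpha>\<^esub> {z \<in> \<D>. \<phi> z \<in> carleson_window \<xi> h}"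
      proof (rule mult_mono)
        have "L powr (\<alpha> + 2) = 1 powr (\<alpha> + 2) / (16 * \<epsilon>) powr (\<alpha> + 2)"
          unfolding L_def by (rule powr_divide)
        then have "L powr - (\<alpha> + 2) = (16 * \<epsilon>) powr (\<alpha> + 2)"
          unfolding powr_minus by simp
        also have "\<dots> = 16 powr (\<alpha> + 2) * \<epsilon> powr (\<alpha> + 2)"
          using \<epsilon> by (simp add: powr_mult)
        finally have "K * L powr - (\<alpha> + 2) = K * 16 powr (\<alpha> + 2) * \<epsilon> powr (\<alpha> + 2)"
          by (simp only: mult.assoc)
        also have "\<dots> \<le> C * \<epsilon> powr (\<alpha> + 2)"
          using C(2) by (rule mult_right_mono) simp
        finally show "ennreal (K * L powr - (\<alpha> + 2)) \<le> ennreal (C * \<epsilon> powr (\<alpha> + 2))"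
          by (rule ennreal_leI)
        show "emeasure \<A>\<^bsub>\<alpha>\<^esub> {z \<in> \<D>. norm (f z) > 1} \<le> emeasure \<A>\<^bsub>\<alpha>\<^esub> {z \<in> \<D>. \<phi> z \<in> carleson_window \<xi> h}"
        proof (intro emeasure_mono sW subsetI)
          fix z assume z: "z \<in> {z \<in> \<D>. norm (f z) > 1}"
          then have z1: "norm z < 1" by simp
          have "norm (1 - \<phi> z * cnj \<xi>) < h / 4"
            using z nz[OF z1] by (simp add: nf less_divide_eq)
          then have "\<phi> z \<in> carleson_window \<xi> h"
            using carleson_window_of_norm_one_minus_less[OF \<xi> h(1) h1 \<phi>1[OF z1]] by simp
          then show "z \<in> {z \<in> \<D>. \<phi> z \<in> carleson_window \<xi> h}" using z1 by simp
        qed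
      qed auto
      finally show ?thesis .
    qed
  qed
  show ?thesis
  proof (rule exI[of _ C], intro conjI allI impI C(1))
    fix \<phi> :: "complex \<Rightarrow> complex"
    assume \<phi>: "\<phi> analytic_on \<D> \<and> \<phi> ` \<D> \<subseteq> \<D>"
    then have "norm (\<phi> 0) < 1" by (simp add: image_subset_iff)
    moreover have "-1 < norm (\<phi> 0)" by (rule less_le_trans[OF _ norm_ge_zero]) simp
    ultimately have h0: "0 < (1 - norm (\<phi> 0)) / 2" "(1 - norm (\<phi> 0)) / 2 < 1" by simp_all
    show "\<exists>h\<^sub>0::real. 0 < h\<^sub>0 \<and> h\<^sub>0 < 1 \<and>
        (\<forall>h::real. \<forall>\<epsilon>::real. \<forall>\<xi>::complex.
          0 < h \<and> h < h\<^sub>0 \<and> 0 < \<epsilon> \<and> \<epsilon> < 1 \<and> \<xi> \<in> \<T> \<longrightarrow>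
          emeasure \<A>\<^bsub>\<alpha>\<^esub> {z \<in> \<D>. \<phi> z \<in> carleson_window \<xi> (\<epsilon> * h)}
            \<le> ennreal (C * \<epsilon> powr (\<alpha> + 2)) *
              emeasure \<A>\<^bsub>\<alpha>\<^esub> {z \<in> \<D>. \<phi> z \<in> carleson_window \<xi> h})"
    proof (intro exI[of _ "(1 - norm (\<phi> 0)) / 2"] conjI allI impI h0)
      fix h \<epsilon> :: real and \<xi> :: complex
      assume *: "0 < h \<and> h < (1 - norm (\<phi> 0)) / 2 \<and> 0 < \<epsilon> \<and> \<epsilon> < 1 \<and> \<xi> \<in> \<T>"
      show "emeasure \<A>\<^bsub>\<alpha>\<^esub> {z \<in> \<D>. \<phi> z \<in> carleson_window \<xi> (\<epsilon> * h)}
            \<le> ennreal (C * \<epsilon> powr (\<alpha> + 2)) *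
              emeasure \<A>\<^bsub>\<alpha>\<^esub> {z \<in> \<D>. \<phi> z \<in> carleson_window \<xi> h}"
        by (rule main) (use \<phi> * in simp_all)
    qed
  qed
qed

end
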